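(* Let $d \ge 2$ and $n > d$ be integers such that $\lfloor d/2 \rfloor$ divides $n$ if $d$ is even, and divides $n-1$ if $d$ is odd; let $P^*(n,d)$ be the polytope constructed below and $c^*(n,d)$ the dual cyclic polytope. Then for $k < \lceil d/2\rceil$ \[ f_k(c^*(n,d)) = O\!\left(\mathrm{poly}(d)\cdot e^{\lfloor d/2\rfloor}\right)\cdot f_k(P^*(n,d)), \] and for $k \ge \lceil d/2 \rceil$ \[ f_k(c^*(n,d)) = O\!\left(\mathrm{poly}(d)\cdot e^{d-k}\right)\cdot f_k(P^*(n,d)), \] where $\mathrm{poly}(d)$ denotes some polynomial in $d$ (and the implicit constants do not depend on $n$).
   Context: For a polytope $P$, $f_k(P)$ denotes the number of $k$-dimensional faces of $P$. The dual cyclic polytope $c^*(n,d)$ is the polar of the $d$-dimensional cyclic polytope with $n$ vertices; by McMullen's Upper Bound Theorem, $f_k(c^*(n,d)) = \sum_{r=\min\{k,\lceil d/2\rceil\}}^{\lceil d/2\rceil-1}\binom{n-d-1+r}{r}\binom{r}{k} + \sum_{r=\max\{k,\lceil d/2\rceil\}}^{d}\binom{n-r-1}{d-r}\binom{r}{k}$. Construction of $P^*(n,d)$: if $d$ is even, for each $1 \le i \le d/2$ let $P_i^*$ be a polygon in the $(x_{2i-1},x_{2i})$-plane given by $n/(d/2)$ linear constraints in $x_{2i-1},x_{2i}$ and having $n/(d/2)$ vertices, and set $P^*(n,d) = \{x\in\mathbb{R}^d : (x_{2i-1},x_{2i}) \in P_i^* \text{ for all } i\}$, defined by the union of these $n$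 constraints. If $d$ is odd, set $P^*(n,d) = \{x \in \mathbb{R}^d : (x_1,\dots,x_{d-1}) \in P^*(n-1,d-1),\ x_d \ge 0\}$. *)

theory Defs
  imports
    "HOL-Analysis.Analysis"
    "HOL-Analysis.Finite_Function_Topology"
    "HOL-Computational_Algebra.Polynomial"
begin

text \<open>
  The bounds are uniform in the dimension, so the dimension has to be a number rather than a type.
  The spaces $\mathbb{R}^d$ for varying \<open>d\<close> are taken to be the subspaces of
  \<open>nat \<Rightarrow>\<^sub>0 real\<close> of the vectors with coordinates \<open>0, \<dots>, d - 1\<close>; coordinates are counted from 0.
\<close>

definition Rn :: "nat \<Rightarrow> (nat \<Rightarrow>\<^sub>0 real) set" where
  "Rn d = {x. Poly_Mapping.keys x \<subseteq> {..<d}}"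

definition dot :: "nat \<Rightarrow> (nat \<Rightarrow>\<^sub>0 real) \<Rightarrow> (nat \<Rightarrow>\<^sub>0 real) \<Rightarrow> real" where
  "dot d x y = (\<Sum>i<d. Poly_Mapping.lookup x i * Poly_Mapping.lookup y i)"

text \<open>
  Affine dimension of a nonempty set, as the dimension of the direction space of its affine hull.
  The constant \<open>aff_dim\<close> is only available in Euclidean spaces; there the two agree.
\<close>

definition affine_dim :: "'a::real_vector set \<Rightarrow> nat" where
  "affine_dim S = dim {x - y | x y. x \<in> S \<and> y \<in> S}"

lemma aff_dim_eq_affine_dim:
  fixes S :: "'a::euclidean_space set"
  assumes "S \<noteq> {}"
  shows "aff_dim S = int (affine_dim S)"
proof -
  from assms obtain a where a: "a \<in> S" by auto
  let ?A = "(+) (- a) ` S" and ?D = "{x - y | x y. x \<in> S \<and> y \<in> S}"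
  have "?D \<subseteq> span ?A"
  proof
    fix z assume "z \<in> ?D"
    then obtain x y where "x \<in> S" "y \<in> S" and z: "z = (- a + x) - (- a + y)" by auto
    then show "z \<in> span ?A"
      unfolding z by (intro span_diff span_base imageI)
  qed
  moreover have "?A \<subseteq> ?D"
  proof
    fix z assume "z \<in> ?A"
    then obtain x where "x \<in> S" "z = x - a" by auto
    with a show "z \<in> ?D" by blast
  qed
  then have "?A \<subseteq> span ?D"
    using span_superset by (rule order_trans)
  ultimately have "span ?A = span ?D"
    by (simp add: span_eq)
  then have "dim ?A = dim ?D"
    using dim_span[of ?A] dim_span[of ?D] by simp
  then show ?thesis
    using aff_dim_eq_dim[of a S] a by (simp add: affine_dim_def hull_inc)
qed

text \<open>$f_k$: the number of \<open>k\<close>-dimensional faces.\<close>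

definition fnum :: "nat \<Rightarrow> 'a::real_vector set \<Rightarrow> nat" where
  "fnum k P = card {F. F face_of P \<and> F \<noteq> {} \<and> affine_dim F = k}"

definition moment_curve :: "nat \<Rightarrow> real \<Rightarrow> (nat \<Rightarrow>\<^sub>0 real)" where
  "moment_curve d t = (\<Sum>i<d. Poly_Mapping.single i (t ^ (i + 1)))"

definition cyclic_polytope :: "nat \<Rightarrow> nat \<Rightarrow> (nat \<Rightarrow> real) \<Rightarrow> (nat \<Rightarrow>\<^sub>0 real) set" where
  "cyclic_polytope n d t = convex hull ((\<lambda>j. moment_curve d (t j)) ` {..<n})"

definition polar :: "nat \<Rightarrow> (nat \<Rightarrow>\<^sub>0 real) set \<Rightarrow> (nat \<Rightarrow>\<^sub>0 real) set" where
  "polar d S = {y \<in> Rn d. \<forall>x\<in>S. dot d x y \<le> 1}"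

text \<open>
  The cyclic polytope is determined only up to the choice of the nodes, and its polar is taken
  with respect to an interior point \<open>c\<close>. All these choices are admitted; the combinatorial type
  does not depend on them.
\<close>

definition dual_cyclic :: "nat \<Rightarrow> nat \<Rightarrow> (nat \<Rightarrow>\<^sub>0 real) set \<Rightarrow> bool" where
  "dual_cyclic n d Q \<longleftrightarrow>
     (\<exists>t c. strict_mono_on {..<n} t \<and>
            c \<in> (top_of_set (Rn d)) interior_of (cyclic_polytope n d t) \<and>
            Q = polar d ((\<lambda>x. x - c) ` cyclic_polytope n d t))"

text \<open>A polygon given by \<open>m\<close> linear constraints and having \<open>m\<close> vertices.\<close>

definition polygon :: "nat \<Rightarrow> (real \<times> real) set \<Rightarrow> bool" where
  "polygon m A \<longleftrightarrow>
     polytope A \<and> aff_dim A = 2 \<and>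
     (\<exists>a b c. A = {(x, y). \<forall>j<m. a j * x + b j * y \<le> c j}) \<and>
     card {v. v extreme_point_of A} = m"

text \<open>
  \<open>P_star n d P\<close>: \<open>P\<close> is one of the sets $P^*(n,d)$, for some choice of the polygons.
  In the odd case the update of \<open>x\<close> is its projection to the first \<open>d - 1\<close> coordinates.
\<close>

inductive P_star :: "nat \<Rightarrow> nat \<Rightarrow> (nat \<Rightarrow>\<^sub>0 real) set \<Rightarrow> bool" where
  even: "even d \<Longrightarrow> (\<And>i. i < d div 2 \<Longrightarrow> polygon (n div (d div 2)) (A i)) \<Longrightarrow>
    P_star n d {x \<in> Rn d. \<forall>i<d div 2.
      (Poly_Mapping.lookup x (2 * i), Poly_Mapping.lookup x (2 * i + 1)) \<in> A i}"
| odd: "odd d \<Longrightarrow> P_star (n - 1) (d - 1) Q \<Longrightarrow>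
    P_star n d {x \<in> Rn d. Poly_Mapping.update (d - 1) 0 x \<in> Q \<and>
      0 \<le> Poly_Mapping.lookup x (d - 1)}"

end

theory Submission
  imports Defs
begin

text \<open>
  Write \<open>h = d div 2\<close>, \<open>s = d - k\<close>, and \<open>n = h m\<close> (\<open>n - 1 = h m\<close> for odd \<open>d\<close>). A \<open>k\<close>-face of the dual
  cyclic polytope is determined by the set of its \<open>s\<close> facets, which is contained in the set of the
  \<open>d\<close> facets of a vertex. By Gale's evenness condition the latter consists of \<open>h\<close> disjoint pairs of
  (cyclically) consecutive nodes, plus an end node for odd \<open>d\<close>. For even \<open>d\<close>, classifying the
  subsets by the number \<open>q\<close> of pairs that they meet gives
  \<open>f\<^sub>k \<le> (\<Sum>q\<le>min h s. (n choose q) * (q choose (s - q)))\<close>.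
  On the other side, a product of \<open>h\<close> polygons with \<open>m\<close> edges and \<open>m\<close> vertices has
  \<open>\<Sum>q\<le>min h s. (h choose q) * m ^ q * (q choose (s - q))\<close> faces of codimension \<open>s\<close>, the coefficient
  of \<open>x ^ s\<close> in \<open>(1 + m x + m x\<^sup>2) ^ h\<close>. The two sums are compared termwise: \<open>h m choose q\<close> is at most
  \<open>exp q * (h choose q) * m ^ q\<close>, and \<open>q\<close> is at most \<open>h\<close> and at most \<open>d - k\<close>. For odd \<open>d\<close> both sides
  get the terms for \<open>s\<close> and \<open>s - 1\<close>, and the two possible end nodes cost a factor of 2.
\<close>

section \<open>Gale sets and their subsets\<close>


text \<open>Combine \<open>N choose q \<le> N^q / q!\<close> for \<open>N = h m\<close> with
  \<open>(h/q)^q \<le> h choose q\<close>. The remaining factor \<open>q^q / q!\<close> is a single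
  term of the exponential series at \<open>q\<close>.\<close>

lemma binomial_mult_le_exp:
  assumes "q \<le> h"
  shows "real ((h * m) choose q) \<le> exp (real q) * (real (h choose q) * real m ^ q)"
proof -
  have "exp (real q) \<ge> real q ^ q / fact q" 
  proof -
    have "(\<lambda>i. inverse (fact i) * real q ^ i) sums exp (real q)"
      using exp_converges[of "real q"] by simp
    then have "sum (\<lambda>i. inverse (fact i) * real q ^ i) {q} \<le> exp (real q)"
      unfolding sums_iff by (metis (no_types, lifting) finite.emptyI finite.insertI fact_ge_zero
        inverse_nonnegative_iff_nonnegative mult_nonneg_nonneg of_nat_0_le_iff sum_le_suminf zero_le_power)
    then show ?thesis by (simp add: field_simps)
  qed
  moreover have "real ((h * m) choose q) \<le> (real h * real m) ^ q / fact q"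
  proof -
    have "real (((h * m) choose q) * fact q) \<le> real ((h * m) ^ q)"
      by (metis binomial_fact_pow of_nat_le_iff)
    then show ?thesis by (simp add: field_simps)
  qed
  moreover have hq: "real h ^ q \<le> real q ^ q * real (h choose q)"
  proof (cases "q = 0")
    case False
    then show ?thesis
      using binomial_ge_n_over_k_pow_k[OF assms, where 'a=real] by (simp add: field_simps)
  qed auto
  moreover have "(real h * real m) ^ q / fact q \<le> real q ^ q * real (h choose q) * real m ^ q / fact q"
    using hq by (simp add: power_mult_distrib divide_right_mono mult_right_mono)
  ultimately have "real ((h * m) choose q) \<le> real q ^ q * real (h choose q) * real m ^ q / fact q"
    by linarith
  also have "\<dots> = (real q ^ q / fact q) * (real (h choose q) * real m ^ q)" by simp
  also have "\<dots> \<le> exp (real q) * (real (h choose q) * real m ^ q)"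
    using \<open>exp (real q) \<ge> real q ^ q / fact q\<close> by (intro mult_right_mono) auto
  finally show ?thesis .
qed

lemma coeff_one_plus_X_power: "poly.coeff ([:1, 1:] ^ q :: 'a::comm_semiring_1 poly) i = of_nat (q choose i)"
proof (induction q arbitrary: i)
  case 0
  then show ?case by (cases i) auto
next
  case (Suc q)
  then show ?case by (cases i) (auto simp: coeff_pCons algebra_simps)
qed

text \<open>Expand \<open>1 + m x (1 + x)\<close> binomially: \<open>q\<close> counts the factors
  from which a non-constant term is taken. The \<open>q\<close>-th summand is divisible by
  \<open>x^q\<close>, so only \<open>q \<le> s\<close> contributes.\<close>

lemma coeff_polygon_power:
  "poly.coeff ([:1, m, m:] ^ h :: 'a::comm_semiring_1 poly) s =
     (\<Sum>q\<le>min h s. of_nat (h choose q) * m ^ q * of_nat (q choose (s - q)))"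
proof -
  have "[:1, m, m:] = monom m 1 * [:1, 1:] + 1"
    by (simp add: monom_altdef one_pCons)
  then have "[:1, m, m:] ^ h = (\<Sum>q\<le>h. of_nat (h choose q) * (monom m 1 * [:1,1:]) ^ q)"
    by (simp add: binomial_ring)
  also have "\<dots> = (\<Sum>q\<le>h. monom (of_nat (h choose q) * m ^ q) q * [:1,1:] ^ q)"
    by (intro sum.cong refl) (simp only: power_mult_distrib monom_power of_nat_monom mult_monom
      mult.assoc[symmetric], simp)
  finally have "poly.coeff ([:1, m, m:] ^ h) s =
      (\<Sum>q\<le>h. if s < q then 0 else of_nat (h choose q) * m ^ q * of_nat (q choose (s - q)))"
    by (simp add: coeff_sum coeff_monom_mult coeff_one_plus_X_power cong: if_cong)
  also have "\<dots> = (\<Sum>q\<le>min h s. of_nat (h choose q) * m ^ q * of_nat (q choose (s - q)))"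
    by (intro sum.mono_neutral_cong_right) auto
  finally show ?thesis .
qed

section \<open>Gale's evenness condition and consecutive pairs\<close>

text \<open>If \<open>x\<close> is the maximum of \<open>V\<close>, a gap at \<open>x - 1\<close>
  would have exactly one element above it, so \<open>x - 1\<close> is in \<open>V\<close>. Removing
  the pair \<open>x - 1, x\<close> keeps all parities, and \<open>J\<close> collects the lower
  elements of the pairs. The interval allows an application after end nodes have been
  removed.\<close>

lemma even_gaps_imp_pairs:
  fixes V :: "nat set"
  assumes "finite V" "even (card V)" "V \<subseteq> {lo..<hi}"
    and "\<And>j. j \<in> {lo..<hi} - V \<Longrightarrow> even (card {i \<in> V. j < i})"
  shows "\<exists>J. J \<inter> Suc ` J = {} \<and> V = J \<union> Suc ` J"
  using assms
proof (induction "card V" arbitrary: V rule: less_induct)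
  case less
  show ?case
  proof (cases "V = {}")
    case True
    then show ?thesis by (intro exI[of _ "{}"]) auto
  next
    case False
    define x where "x = Max V"
    have xV: "x \<in> V" and max: "\<And>i. i \<in> V \<Longrightarrow> i \<le> x"
      using less.prems False by (auto simp: x_def)
    \<comment> \<open>By parity there is a second element, below \<open>x\<close>; it forces
      \<open>x - 1\<close> into the interval, where the gap condition is available.\<close>
    have "V \<noteq> {x}" using less.prems(2) by auto
    then obtain y where y: "y \<in> V" "y \<noteq> x" using xV by blast
    then have "y < x" using max by (simp add: order_less_le)
    have "x - 1 \<in> V"
    proof (rule ccontr)
      assume n: "x - 1 \<notin> V"
      have "x - 1 \<in> {lo..<hi}" using \<open>y < x\<close> y xV less.prems(3) by force
      then have "even (card {i \<in> V. x - 1 < i})" using n less.prems(4) by blast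
      moreover have "{i \<in> V. x - 1 < i} = {x}"
        using xV max \<open>y < x\<close> by force
      ultimately show False by simp
    qed
    define W where "W = V - {x - 1, x}"
    have V: "V = insert (x - 1) (insert x W)" using \<open>x - 1 \<in> V\<close> xV by (auto simp: W_def)
    have fW: "finite W" and nW: "x - 1 \<notin> W" "x \<notin> W" using less.prems(1) by (auto simp: W_def)
    have neq: "x - 1 \<noteq> x" using \<open>y < x\<close> by auto
    have cV: "card V = card W + 2" unfolding V using fW nW neq by simp
    have Wx: "i < x - 1" if "i \<in> W" for i
    proof -
      have "i \<le> x" using that V max by blast
      moreover have "i \<noteq> x" "i \<noteq> x - 1" using that nW by auto
      ultimately show ?thesis by linarith
    qed
    have "\<exists>J. J \<inter> Suc ` J = {} \<and> W = J \<union> Suc ` J"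
    proof (rule less.hyps)
      show "card W < card V" "even (card W)" using cV less.prems(2) by auto
      show "finite W" by fact
      show "W \<subseteq> {lo..<hi}" using less.prems(3) V by auto
      fix j assume j: "j \<in> {lo..<hi} - W"
      show "even (card {i \<in> W. j < i})"
      proof (cases "j < x - 1")
        case True
        then have "j \<in> {lo..<hi} - V" using j by (auto simp: V)
        then have "even (card {i \<in> V. j < i})" using less.prems(4) by blast
        moreover have "{i \<in> V. j < i} = insert (x - 1) (insert x {i \<in> W. j < i})"
          using True by (auto simp: V)
        ultimately show ?thesis using fW nW neq by simp
      next
        case False
        then have "{i \<in> W. j < i} = {}" using Wx by force
        then show ?thesis by (metis card.empty even_zero)
      qed
    qed
    then obtain J where J: "J \<inter> Suc ` J = {}" "W = J \<union> Suc ` J" by blast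
    have "Suc (x - 1) = x" using \<open>y < x\<close> by simp
    then have "insert (x - 1) J \<inter> Suc ` insert (x - 1) J = {}"
      "V = insert (x - 1) J \<union> Suc ` insert (x - 1) J"
      using J V nW neq by auto
    then show ?thesis by blast
  qed
qed

text \<open>If the common parity is even, the pairs are consecutive in the linear order. If it is
  odd, a gap at \<open>n - 1\<close> (nothing above it) or at \<open>0\<close> (all of
  \<open>V\<close> above it) is impossible; so both ends lie in \<open>V\<close> and form one cyclic
  pair, and without them the parities are even.\<close>

lemma gale_even:
  fixes V :: "nat set"
  assumes V: "V \<subseteq> {..<n}" "even (card V)"
    and par: "\<And>i j. i \<in> {..<n} - V \<Longrightarrow> j \<in> {..<n} - V \<Longrightarrow>
       even (card {l \<in> V. i < l}) = even (card {l \<in> V. j < l})"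
  shows "\<exists>J. J \<inter> (\<lambda>i. Suc i mod n) ` J = {} \<and> V = J \<union> (\<lambda>i. Suc i mod n) ` J"
proof (cases "\<forall>j\<in>{..<n} - V. even (card {l \<in> V. j < l})")
  case True
  have "finite V" using V finite_subset by blast
  then obtain J where J: "J \<inter> Suc ` J = {}" "V = J \<union> Suc ` J"
    using even_gaps_imp_pairs[of V 0 n] V True by (auto simp: atLeast0LessThan)
  have "Suc i mod n = Suc i" if "i \<in> J" for i using that J V by auto
  then have "(\<lambda>i. Suc i mod n) ` J = Suc ` J" by auto
  then show ?thesis using J by metis
next
  case False
  then obtain j where "j \<in> {..<n} - V" by blast
  with False par have odd: "odd (card {l \<in> V. j < l})" if "j \<in> {..<n} - V" for j
    using that by metis
  have "finite V" using V finite_subset by blast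
  have j: "j < n" "j \<notin> V" using \<open>j \<in> _\<close> by auto
  have last: "n - 1 \<in> V"
  proof (rule ccontr)
    assume "n - 1 \<notin> V"
    then have "odd (card {l \<in> V. n - 1 < l})" using odd j by auto
    moreover have "{l \<in> V. n - 1 < l} = {}" using V by force
    ultimately show False by (metis card.empty even_zero)
  qed
  have first: "0 \<in> V"
  proof (rule ccontr)
    assume "0 \<notin> V"
    then have "odd (card {l \<in> V. 0 < l})" using odd j by auto
    moreover have "{l \<in> V. 0 < l} = V" using \<open>0 \<notin> V\<close> by (auto intro: gr0I)
    ultimately show False using V by simp
  qed
  have "n - 1 \<noteq> 0" using j first by (cases j) auto
  define W where "W = V - {0, n - 1}"
  have VW: "V = insert 0 (insert (n - 1) W)" and W: "0 \<notin> W" "n - 1 \<notin> W" "finite W"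
    using first last \<open>finite V\<close> by (auto simp: W_def)
  have "\<exists>J. J \<inter> Suc ` J = {} \<and> W = J \<union> Suc ` J"
  proof (rule even_gaps_imp_pairs)
    show "finite W" by fact
    have "card V = card W + 2" unfolding VW using W \<open>n - 1 \<noteq> 0\<close> by simp
    then show "even (card W)" using V by simp
    show "W \<subseteq> {1..<n - 1}"
    proof
      fix i assume "i \<in> W"
      then have "i < n" "i \<noteq> 0" "i \<noteq> n - 1" using V(1) W VW by (auto intro!: gr0I)
      then show "i \<in> {1..<n - 1}" by auto
    qed
    fix j assume j: "j \<in> {1..<n - 1} - W"
    then have "odd (card {l \<in> V. j < l})" by (intro odd) (auto simp: VW)
    moreover have "{l \<in> V. j < l} = insert (n - 1) {l \<in> W. j < l}" using j by (auto simp: VW)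
    ultimately show "even (card {l \<in> W. j < l})" using W by simp
  qed
  then obtain J where J: "J \<inter> Suc ` J = {}" "W = J \<union> Suc ` J" by blast
  have "Suc i mod n = Suc i" if "i \<in> J" for i 
  proof -
    have "Suc i \<in> W" using that J by blast
    then have "Suc i < n" using V VW by auto
    then show ?thesis by simp
  qed
  then have im: "(\<lambda>i. Suc i mod n) ` J = Suc ` J" by auto
  \<comment> \<open>The wrap-around pair: the successor of \<open>n - 1\<close> modulo
    \<open>n\<close> is \<open>0\<close>.\<close>
  let ?J = "insert (n - 1) J"
  have s0: "Suc (n - 1) mod n = 0" using \<open>n - 1 \<noteq> 0\<close> by simp
  have "(\<lambda>i. Suc i mod n) ` ?J = insert 0 (Suc ` J)" using im s0 by simp
  then have "?J \<inter> (\<lambda>i. Suc i mod n) ` ?J = {}" "V = ?J \<union> (\<lambda>i. Suc i mod n) ` ?J"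
    using J VW W \<open>n - 1 \<noteq> 0\<close> by auto
  then show ?thesis by blast
qed

text \<open>For even common parity the node \<open>0\<close> must lie in \<open>V\<close>, because
  otherwise all of the odd set \<open>V\<close> is above the gap \<open>0\<close>; for odd parity
  \<open>n - 1\<close> must lie in \<open>V\<close>. Without that end node the rest has even gaps
  and splits into pairs that never wrap around.\<close>

lemma gale_odd:
  fixes V :: "nat set"
  assumes V: "V \<subseteq> {..<n}" "odd (card V)"
    and par: "\<And>i j. i \<in> {..<n} - V \<Longrightarrow> j \<in> {..<n} - V \<Longrightarrow>
       even (card {l \<in> V. i < l}) = even (card {l \<in> V. j < l})"
  shows "\<exists>e\<in>{0, n - 1}. \<exists>J. J \<inter> Suc ` J = {} \<and> e \<notin> J \<union> Suc ` J \<and> V = insert e (J \<union> Suc ` J)"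
proof (cases "\<forall>j\<in>{..<n} - V. even (card {l \<in> V. j < l})")
  case True
  have fin: "finite V" using V finite_subset by blast
  have "V \<noteq> {}" using V by auto
  then have "0 < n" using V by auto
  have first: "0 \<in> V"
  proof (rule ccontr)
    assume "0 \<notin> V"
    then have "even (card {l \<in> V. 0 < l})" using True \<open>0 < n\<close> by auto
    moreover have "{l \<in> V. 0 < l} = V" using \<open>0 \<notin> V\<close> by (auto intro: gr0I)
    ultimately show False using V by simp
  qed
  have "\<exists>J. J \<inter> Suc ` J = {} \<and> V - {0} = J \<union> Suc ` J"
  proof (rule even_gaps_imp_pairs)
    show "finite (V - {0})" "even (card (V - {0}))" using fin first V by auto
    show "V - {0} \<subseteq> {1..<n}" using V by (auto simp: Suc_le_eq)
    fix j assume j: "j \<in> {1..<n} - (V - {0})"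
    then have "even (card {l \<in> V. j < l})" using True by auto
    moreover have "{l \<in> V. j < l} = {l \<in> V - {0}. j < l}" by auto
    ultimately show "even (card {l \<in> V - {0}. j < l})" by simp
  qed
  then show ?thesis using first by (metis Diff_iff insertCI insert_Diff)
next
  case False
  then obtain j where "j \<in> {..<n} - V" by blast
  with False par have odd: "odd (card {l \<in> V. j < l})" if "j \<in> {..<n} - V" for j
    using that by metis
  have fin: "finite V" using V finite_subset by blast
  have j: "j < n" "j \<notin> V" using \<open>j \<in> _\<close> by auto
  have last: "n - 1 \<in> V"
  proof (rule ccontr)
    assume "n - 1 \<notin> V"
    then have "odd (card {l \<in> V. n - 1 < l})" using odd j by auto
    moreover have "{l \<in> V. n - 1 < l} = {}" using V by force
    ultimately show False by (metis card.empty even_zero)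
  qed
  have "\<exists>J. J \<inter> Suc ` J = {} \<and> V - {n - 1} = J \<union> Suc ` J"
  proof (rule even_gaps_imp_pairs)
    show "finite (V - {n - 1})" "even (card (V - {n - 1}))" using fin last V by auto
    show "V - {n - 1} \<subseteq> {0..<n - 1}" using V by (auto dest!: subsetD)
    fix j assume j: "j \<in> {0..<n - 1} - (V - {n - 1})"
    then have "odd (card {l \<in> V. j < l})" by (intro odd) auto
    moreover have "{l \<in> V. j < l} = insert (n - 1) {l \<in> V - {n - 1}. j < l}" using j last by auto
    ultimately show "even (card {l \<in> V - {n - 1}. j < l})" using fin by simp
  qed
  then show ?thesis using last by (metis Diff_iff insertCI insert_Diff)
qed

section \<open>Counting subsets of unions of pairs\<close>

text \<open>A set \<open>I\<close> is encoded by one representative of each pair that it meets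
  (\<open>K\<close>, of size \<open>q\<close>) and by the pairs that it contains entirely
  (\<open>L\<close>, of size \<open>s - q\<close>). The code determines \<open>I\<close> without
  knowledge of \<open>J\<close>, since \<open>\<sigma>\<close> is fixed.\<close>

lemma card_subsets_of_pairs_le:
  assumes X: "finite X" "card X = N"
    and \<I>: "\<And>I. I \<in> \<I> \<Longrightarrow> card I = s \<and> 
      (\<exists>J. card J \<le> h \<and> J \<inter> \<sigma> ` J = {} \<and> inj_on \<sigma> J \<and> J \<union> \<sigma> ` J \<subseteq> X \<and> I \<subseteq> J \<union> \<sigma> ` J)"
  shows "finite \<I> \<and> card \<I> \<le> (\<Sum>q\<le>min h s. (N choose q) * (q choose (s - q)))"
proof -
  define C where "C q = (SIGMA K:{K. K \<subseteq> X \<and> card K = q}. {L. L \<subseteq> K \<and> card L = s - q})" for q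
  have finK: "finite K" if "K \<subseteq> X" for K using that X finite_subset by blast
  have finC: "finite (C q)" for q unfolding C_def 
    using X finK by (intro finite_SigmaI) auto
  have cardC: "card (C q) = (N choose q) * (q choose (s - q))" for q
  proof -
    have "card (C q) = (\<Sum>K | K \<subseteq> X \<and> card K = q. card {L. L \<subseteq> K \<and> card L = s - q})"
      unfolding C_def using X finK by (subst card_SigmaI) auto
    also have "\<dots> = (\<Sum>K | K \<subseteq> X \<and> card K = q. q choose (s - q))"
      by (intro sum.cong) (use n_subsets finK in auto)
    also have "\<dots> = (N choose q) * (q choose (s - q))" using n_subsets[OF X(1)] X(2) by simp
    finally show ?thesis .
  qed
  define \<C> where "\<C> = (\<Union>q\<le>min h s. C q)"
  \<comment> \<open>For an upper bound it suffices that decoding is onto; not every pair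
    \<open>K\<close>, \<open>L\<close> need come from some \<open>I\<close>.\<close>
  have "\<I> \<subseteq> (\<lambda>(K, L). K \<union> \<sigma> ` L) ` \<C>"
  proof
    fix I assume "I \<in> \<I>"
    then obtain J where s: "card I = s" and J: "card J \<le> h" "J \<inter> \<sigma> ` J = {}" "inj_on \<sigma> J"
      "J \<union> \<sigma> ` J \<subseteq> X" "I \<subseteq> J \<union> \<sigma> ` J" using \<I>[OF \<open>I \<in> \<I>\<close>] by auto
    \<comment> \<open>The representative is the first element of the pair if it lies in
      \<open>I\<close>, and the second otherwise. For a pair inside \<open>I\<close> the second
      element is restored by applying \<open>\<sigma>\<close> to \<open>L\<close>.\<close>
    define K where "K = (\<lambda>j. if j \<in> I then j else \<sigma> j) ` {j \<in> J. j \<in> I \<or> \<sigma> j \<in> I}"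
    define L where "L = {j \<in> J. j \<in> I \<and> \<sigma> j \<in> I}"
    have "finite (J \<union> \<sigma> ` J)" using J(4) X(1) by (rule finite_subset)
    then have fin: "finite J" "finite I" using J(5) by (auto dest: finite_subset)
    have LK: "L \<subseteq> K" by (force simp: K_def L_def)
    have I: "I = K \<union> \<sigma> ` L"
      using J(5) by (auto simp: K_def L_def split: if_splits)
    have disj: "K \<inter> \<sigma> ` L = {}"
      using J(2,3) by (auto simp: K_def L_def inj_on_def split: if_splits)
    have finKL: "finite K" "finite L" using fin by (auto simp: K_def L_def)
    have "card K \<le> card {j \<in> J. j \<in> I \<or> \<sigma> j \<in> I}" unfolding K_def using fin by (intro card_image_le) auto
    also have "\<dots> \<le> card J" using fin by (intro card_mono) auto
    finally have "card K \<le> h" using J by simp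
    have "card (\<sigma> ` L) = card L" using J(3) by (intro card_image) (auto simp: L_def inj_on_def)
    then have "s = card K + card L"
      using card_Un_disjoint[OF finKL(1) _ disj] finKL I s by simp
    moreover have "K \<subseteq> X" using I J(4,5) by (metis Un_upper1 order_trans)
    ultimately have "(K, L) \<in> \<C>" using LK \<open>card K \<le> h\<close> by (auto simp: \<C>_def C_def)
    then show "I \<in> (\<lambda>(K, L). K \<union> \<sigma> ` L) ` \<C>" using I by force
  qed
  moreover have "finite \<C>" using finC by (auto simp: \<C>_def)
  ultimately have "finite \<I>" "card \<I> \<le> card \<C>"
    by (simp_all add: finite_surj surj_card_le)
  moreover have "card \<C> \<le> (\<Sum>q\<le>min h s. card (C q))" unfolding \<C>_def by (rule card_UN_le) simp
  ultimately show ?thesis by (simp add: cardC)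
qed

lemma sum_binomial_le_coeff:
  "real (\<Sum>q\<le>min h s. ((h * m) choose q) * (q choose (s - q)))
     \<le> exp (real (min h s)) * real (poly.coeff ([:1, m, m:] ^ h) s)"
proof -
  have "real (\<Sum>q\<le>min h s. ((h * m) choose q) * (q choose (s - q))) =
     (\<Sum>q\<le>min h s. real ((h * m) choose q) * real (q choose (s - q)))" by simp
  also have "\<dots> \<le> (\<Sum>q\<le>min h s. exp (real (min h s)) * (real (h choose q) * real m ^ q) * real (q choose (s - q)))"
  proof (intro sum_mono mult_right_mono)
    fix q assume "q \<in> {..min h s}"
    then have "exp (real q) \<le> exp (real (min h s))" by simp
    then show "real ((h * m) choose q) \<le> exp (real (min h s)) * (real (h choose q) * real m ^ q)"
      by (intro order_trans[OF binomial_mult_le_exp] mult_right_mono) auto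
  qed auto
  also have "\<dots> = exp (real (min h s)) * real (poly.coeff ([:1, m, m:] ^ h) s)"
    by (subst coeff_polygon_power) (simp add: sum_distrib_left mult.assoc)
  finally show ?thesis .
qed

section \<open>Faces of polyhedra in H-representation\<close>


definition active :: "('j \<Rightarrow> 'v \<Rightarrow> real) \<Rightarrow> ('j \<Rightarrow> real) \<Rightarrow> 'j set \<Rightarrow> 'v set \<Rightarrow> 'j set" where
  "active a b J F = {j \<in> J. \<forall>y\<in>F. a j y = b j}"

text \<open>Produces a relative interior point of \<open>F\<close>: each inequality that is not
  tight on all of \<open>F\<close> is strict somewhere, and midpoints preserve the strictness
  already obtained.\<close>

lemma ex_common_slack:
  fixes a :: "'j \<Rightarrow> 'v::real_vector \<Rightarrow> real"
  assumes "finite J" "\<And>j. j \<in> J \<Longrightarrow> linear (a j)" "convex F" "F \<noteq> {}"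
    and "\<And>j y. j \<in> J \<Longrightarrow> y \<in> F \<Longrightarrow> a j y \<le> b j"
  shows "\<exists>y\<in>F. \<forall>j\<in>J - active a b J F. a j y < b j"
proof -
  have "\<exists>y\<in>F. \<forall>j\<in>K. a j y < b j" if "K \<subseteq> J - active a b J F" "finite K" for K
    using that(2,1)
  proof (induction K)
    case empty
    then show ?case using assms by auto
  next
    case (insert k K)
    then obtain y where y: "y \<in> F" "\<forall>j\<in>K. a j y < b j" by auto
    from insert.prems have "k \<in> J" "k \<notin> active a b J F" by auto
    then obtain z where z: "z \<in> F" "a k z \<noteq> b k" by (auto simp: active_def)
    then have z': "a k z < b k" using assms(5) \<open>k \<in> J\<close> by (simp add: order_less_le)
    let ?m = "(1 / 2) *\<^sub>R y + (1 / 2) *\<^sub>R z"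
    have "?m \<in> F" using assms(3) y z by (simp add: convexD)
    moreover have "a j ?m < b j" if j: "j \<in> insert k K" for j
    proof -
      have "j \<in> J" using j insert.prems by auto
      then have m: "a j ?m = (a j y + a j z) / 2"
        using assms(2) by (simp add: linear_add linear_scale field_simps)
      have "a j y \<le> b j" "a j z \<le> b j" using assms(5) \<open>j \<in> J\<close> y z by auto
      moreover have "a j y < b j \<or> a j z < b j" using j y z' by auto
      ultimately show ?thesis unfolding m by argo
    qed
    ultimately show ?case by blast
  qed
  from this[of "J - active a b J F"] assms(1) show ?thesis by auto
qed

lemma ex_small_step:
  fixes u w b :: "'j \<Rightarrow> real"
  assumes "finite J" "\<And>j. j \<in> J \<Longrightarrow> u j < b j"
  shows "\<exists>\<epsilon>>0. \<forall>j\<in>J. u j + \<epsilon> * w j \<le> b j"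
  using assms
proof (induction J)
  case empty
  then show ?case by (auto intro: exI[of _ 1])
next
  case (insert k J)
  then obtain e where e: "e > 0" "\<forall>j\<in>J. u j + e * w j \<le> b j" by auto
  \<comment> \<open>The summand 1 avoids a zero denominator; with this step the change
    \<open>f * w k\<close> is at most the slack.\<close>
  define f where "f = (b k - u k) / (\<bar>w k\<bar> + 1)"
  have "f > 0" using insert.prems by (auto simp: f_def)
  have "f * w k \<le> f * (\<bar>w k\<bar> + 1)" using \<open>f > 0\<close> by (intro mult_left_mono) auto
  also have "\<dots> = b k - u k" by (simp add: f_def field_simps)
  finally have fk: "f * w k \<le> b k - u k" .
  have less: "u j + min e f * w j \<le> b j" if "u j < b j" "u j + g * w j \<le> b j" "g \<in> {e, f}" for j g
  proof (cases "w j \<ge> 0")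
    case True
    then have "min e f * w j \<le> g * w j" using that by (intro mult_right_mono) auto
    then show ?thesis using that by linarith
  next
    case False
    then have "min e f * w j \<le> 0" using e \<open>f > 0\<close> by (intro mult_nonneg_nonpos) auto
    then show ?thesis using that by linarith
  qed
  have "\<forall>j\<in>insert k J. u j + min e f * w j \<le> b j"
    using less[of k f] less[of _ e] fk e insert.prems by auto
  then show ?case using e \<open>f > 0\<close> by (intro exI[of _ "min e f"]) auto
qed

text \<open>Let \<open>y0\<close> be strict in every inactive inequality and let \<open>y\<close>
  satisfy the active equations. The segment from \<open>y\<close> to \<open>y0\<close> can be
  prolonged beyond \<open>y0\<close> inside \<open>Q\<close>, so the face property at
  \<open>y0\<close> puts \<open>y\<close> into \<open>F\<close>.\<close>

lemma face_eq_active: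
  fixes a :: "'j \<Rightarrow> 'v::real_vector \<Rightarrow> real"
  assumes J: "finite J" "\<And>j. j \<in> J \<Longrightarrow> linear (a j)" and E: "subspace E"
    and Q: "Q = {y \<in> E. \<forall>j\<in>J. a j y \<le> b j}"
    and F: "F face_of Q" "F \<noteq> {}"
  shows "F = {y \<in> Q. \<forall>j\<in>active a b J F. a j y = b j}"
proof
  show "F \<subseteq> {y \<in> Q. \<forall>j\<in>active a b J F. a j y = b j}"
    using face_of_imp_subset[OF F(1)] by (auto simp: active_def)
  have FQ: "F \<subseteq> Q" using face_of_imp_subset[OF F(1)] .
  have "convex F" using F face_of_imp_convex by blast
  then obtain y0 where y0: "y0 \<in> F" "\<forall>j\<in>J - active a b J F. a j y0 < b j"
    using ex_common_slack[of J a F b, OF J] F FQ unfolding Q by blast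
  show "{y \<in> Q. \<forall>j\<in>active a b J F. a j y = b j} \<subseteq> F"
  proof
    fix y assume "y \<in> {y \<in> Q. \<forall>j\<in>active a b J F. a j y = b j}"
    then have y: "y \<in> Q" "\<And>j. j \<in> active a b J F \<Longrightarrow> a j y = b j" by auto
    obtain e where e: "e > 0" "\<And>j. j \<in> J - active a b J F \<Longrightarrow> a j y0 + e * (a j y0 - a j y) \<le> b j"
      using ex_small_step[of "J - active a b J F" "\<lambda>j. a j y0" b "\<lambda>j. a j y0 - a j y"] J y0 by auto
    \<comment> \<open>On active inequalities \<open>y\<close> and \<open>y0\<close> agree, so
      \<open>z\<close> stays tight there; on the others the step \<open>e\<close> is small
      enough.\<close>
    define z where "z = y0 + e *\<^sub>R (y0 - y)"
    have "z \<in> E" using y0 y FQ E unfolding z_def Q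
      by (auto intro!: subspace_add subspace_scale subspace_diff)
    moreover have "a j z \<le> b j" if "j \<in> J" for j
    proof -
      have az: "a j z = a j y0 + e * (a j y0 - a j y)"
        using J(2)[OF that] by (simp add: z_def linear_add linear_scale linear_diff)
      show ?thesis
      proof (cases "j \<in> active a b J F")
        case True
        then have "a j y0 = b j" using y0 by (auto simp: active_def)
        then show ?thesis using az y(2)[OF True] by simp
      next
        case False
        then show ?thesis using az e that by simp
      qed
    qed
    ultimately have "z \<in> Q" by (simp add: Q)
    show "y \<in> F"
    proof (cases "y = y0")
      case False
      have "z = y0 + e *\<^sub>R (y0 - y)" by (rule z_def)
      \<comment> \<open>Solving for \<open>y0\<close> exhibits it as a proper convex combination of
        \<open>z\<close> and \<open>y\<close> with weights \<open>1/(1+e)\<close> and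
        \<open>e/(1+e)\<close>.\<close>
      then have "(1 + e) *\<^sub>R y0 = z + e *\<^sub>R y" by (simp add: algebra_simps)
      then have "(1 / (1 + e)) *\<^sub>R ((1 + e) *\<^sub>R y0) = (1 / (1 + e)) *\<^sub>R (z + e *\<^sub>R y)" by simp
      then have "y0 = (1 / (1 + e)) *\<^sub>R z + (e / (1 + e)) *\<^sub>R y"
        using e by (simp add: scaleR_right_distrib)
      moreover have "1 - e / (1 + e) = 1 / (1 + e)" using e by (simp add: field_simps)
      moreover have "z \<noteq> y"
      proof
        assume "z = y"
        then have "(1 + e) *\<^sub>R y0 = (1 + e) *\<^sub>R y"
          using \<open>(1 + e) *\<^sub>R y0 = z + e *\<^sub>R y\<close> by (simp add: algebra_simps)
        then show False using e False by simp
      qed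
      ultimately have "y0 \<in> open_segment z y"
        using e by (auto simp: in_segment intro!: exI[of _ "e / (1 + e)"])
      then show ?thesis using F \<open>z \<in> Q\<close> y y0 unfolding face_of_def by blast
    qed (use y0 in simp)
  qed
qed

text \<open>From a point of \<open>F\<close> that is strict in all inactive inequalities, a short
  step in any direction killed by the active functionals stays in \<open>F\<close>. Hence the
  differences of points of \<open>F\<close> span this whole kernel.\<close>

lemma affine_dim_face:
  fixes a :: "'j \<Rightarrow> 'v::real_vector \<Rightarrow> real"
  assumes J: "finite J" "\<And>j. j \<in> J \<Longrightarrow> linear (a j)" and E: "subspace E"
    and Q: "Q = {y \<in> E. \<forall>j\<in>J. a j y \<le> b j}"
    and F: "F face_of Q" "F \<noteq> {}"
  shows "affine_dim F = dim {v \<in> E. \<forall>j\<in>active a b J F. a j v = 0}"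
proof -
  let ?D = "{x - y | x y. x \<in> F \<and> y \<in> F}" and ?W = "{v \<in> E. \<forall>j\<in>active a b J F. a j v = 0}"
  have FQ: "F \<subseteq> Q" using face_of_imp_subset[OF F(1)] .
  have lin: "linear (a j)" if "j \<in> active a b J F" for j
    using that J by (auto simp: active_def)
  have "convex F" using F face_of_imp_convex by blast
  then obtain y0 where y0: "y0 \<in> F" "\<forall>j\<in>J - active a b J F. a j y0 < b j"
    using ex_common_slack[of J a F b, OF J] F FQ unfolding Q by blast
  have "?D \<subseteq> ?W"
  proof clarify
    fix x y assume "x \<in> F" "y \<in> F"
    then show "x - y \<in> E \<and> (\<forall>j\<in>active a b J F. a j (x - y) = 0)"
      using FQ E lin by (auto simp: Q active_def linear_diff subset_iff intro!: subspace_diff)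
  qed
  moreover have "?W \<subseteq> span ?D"
  proof
    fix v assume v: "v \<in> ?W"
    obtain e where e: "e > 0" "\<And>j. j \<in> J - active a b J F \<Longrightarrow> a j y0 + e * a j v \<le> b j"
      using ex_small_step[of "J - active a b J F" "\<lambda>j. a j y0" b "\<lambda>j. a j v"] J y0 by auto
    define z where "z = y0 + e *\<^sub>R v"
    have "z \<in> E" using y0 v FQ E unfolding z_def Q
      by (auto intro!: subspace_add subspace_scale)
    have az: "a j z = a j y0 + e * a j v" if "j \<in> J" for j
      using J(2)[OF that] by (simp add: z_def linear_add linear_scale)
    have act: "a j z = b j" if "j \<in> active a b J F" for j
      using that az[of j] v y0 by (auto simp: active_def)
    have "a j z \<le> b j" if "j \<in> J" for j
      using e(2)[of j] az[OF that] act[of j] that by (cases "j \<in> active a b J F") auto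
    then have "z \<in> Q" using \<open>z \<in> E\<close> unfolding Q by simp
    then have "z \<in> F" using act face_eq_active[OF J E Q F] by blast
    then have "z - y0 \<in> span ?D" using y0 by (intro span_base) blast
    then have "(1 / e) *\<^sub>R (z - y0) \<in> span ?D" by (rule span_scale)
    then show "v \<in> span ?D" using e by (simp add: z_def)
  qed
  moreover have "subspace ?W"
    using E lin by (auto simp: subspace_def linear_add linear_scale linear_0)
  ultimately have "span ?D = ?W"
    by (metis (no_types, lifting) span_minimal subset_antisym)
  then show ?thesis unfolding affine_dim_def using dim_span[of ?D] by simp
qed

text \<open>Up to scaling, \<open>w\<close> is a basis of \<open>E\<close> dual to the functionals
  in \<open>V\<close>; the members with index outside \<open>I\<close> form a basis of the common
  kernel of those in \<open>I\<close>.\<close>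

lemma dim_kernel_dual_basis:
  fixes a :: "'j \<Rightarrow> 'v::real_vector \<Rightarrow> real"
  assumes V: "finite V" "I \<subseteq> V" "\<And>j. j \<in> V \<Longrightarrow> linear (a j)" and E: "subspace E"
    and w: "\<And>j. j \<in> V \<Longrightarrow> w j \<in> E" "\<And>j. j \<in> V \<Longrightarrow> a j (w j) \<noteq> 0"
      "\<And>i j. i \<in> V \<Longrightarrow> j \<in> V \<Longrightarrow> i \<noteq> j \<Longrightarrow> a i (w j) = 0"
    and ker: "\<And>v. v \<in> E \<Longrightarrow> (\<And>i. i \<in> V \<Longrightarrow> a i v = 0) \<Longrightarrow> v = 0"
  shows "dim {v \<in> E. \<forall>j\<in>I. a j v = 0} = card (V - I)"
proof (rule dim_unique)
  have inj: "inj_on w V" 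
    using w(2,3) by (metis inj_onI)
  have fin: "finite (V - I)" using V by simp
  show "w ` (V - I) \<subseteq> {v \<in> E. \<forall>j\<in>I. a j v = 0}"
  proof clarify
    fix i assume "i \<in> V" "i \<notin> I"
    then show "w i \<in> E \<and> (\<forall>j\<in>I. a j (w i) = 0)" using w(1) w(3)[of _ i] V(2) by auto
  qed
  show "card (w ` (V - I)) = card (V - I)" using inj by (intro card_image) (auto simp: inj_on_def)
  show "independent (w ` (V - I))"
  proof -
    have "u (w j) = 0" if s: "(\<Sum>v\<in>w ` (V - I). u v *\<^sub>R v) = 0" and j: "j \<in> V - I" for u j
    proof -
      have "(\<Sum>i\<in>V - I. u (w i) *\<^sub>R w i) = 0"
        using s by (subst (asm) sum.reindex) (use inj in \<open>auto simp: inj_on_def\<close>)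
      then have "a j (\<Sum>i\<in>V - I. u (w i) *\<^sub>R w i) = 0" using V j by (simp add: linear_0)
      then have "(\<Sum>i\<in>V - I. u (w i) * a j (w i)) = 0"
        using V j by (simp add: linear_sum linear_scale)
      moreover have "(\<Sum>i\<in>V - I. u (w i) * a j (w i)) = (\<Sum>i\<in>V - I. if i = j then u (w j) * a j (w j) else 0)"
        using w j by (intro sum.cong) auto
      ultimately show ?thesis using fin j w(2)[of j] by simp
    qed
    then show ?thesis using fin by (auto simp: dependent_finite)
  qed
  show "{v \<in> E. \<forall>j\<in>I. a j v = 0} \<subseteq> span (w ` (V - I))"
  proof
    fix v assume v: "v \<in> {v \<in> E. \<forall>j\<in>I. a j v = 0}"
    \<comment> \<open>The expansion of \<open>v\<close> in the dual basis; all functionals in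
      \<open>V\<close> agree on \<open>v\<close> and \<open>x\<close>.\<close>
    define x where "x = (\<Sum>i\<in>V - I. (a i v / a i (w i)) *\<^sub>R w i)"
    have "v - x = 0"
    proof (rule ker)
      show "v - x \<in> E" unfolding x_def using v w E
        by (auto intro!: subspace_diff subspace_sum subspace_scale)
      fix j assume j: "j \<in> V"
      have "a j x = (\<Sum>i\<in>V - I. (a i v / a i (w i)) * a j (w i))"
        using V j by (simp add: x_def linear_sum linear_scale)
      also have "\<dots> = (\<Sum>i\<in>V - I. if i = j then a j v else 0)"
        using w j by (intro sum.cong) auto
      also have "\<dots> = a j v" using fin v j by auto
      finally show "a j (v - x) = 0" using V j by (simp add: linear_diff)
    qed
    moreover have "x \<in> span (w ` (V - I))" unfolding x_def
      by (intro span_sum span_scale span_base) auto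
    ultimately show "v \<in> span (w ` (V - I))" by simp
  qed
qed

section \<open>The polar of a cyclic polytope\<close>


lemma in_Rn_iff: "x \<in> Rn d \<longleftrightarrow> (\<forall>i\<ge>d. Poly_Mapping.lookup x i = 0)"
  by (auto simp: Rn_def in_keys_iff subset_iff not_less[symmetric])

lemma lookup_scaleR [simp]: "Poly_Mapping.lookup (r *\<^sub>R x) i = r * Poly_Mapping.lookup x i"
  by (simp add: scaleR_poly_mapping_def Poly_Mapping.map.rep_eq when_def)

lemma subspace_Rn: "subspace (Rn d)"
  by (auto simp: subspace_def in_Rn_iff lookup_add)

lemma linear_dot_right: "linear (dot d x)"
  by (rule linearI) (simp_all add: dot_def lookup_add distrib_left sum.distrib sum_distrib_left algebra_simps)

lemma linear_dot_left: "linear (\<lambda>x. dot d x y)"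
  by (rule linearI) (simp_all add: dot_def lookup_add distrib_right sum.distrib sum_distrib_left algebra_simps)

lemma lookup_moment_curve:
  "Poly_Mapping.lookup (moment_curve d t) l = (if l < d then t ^ Suc l else 0)"
proof -
  have "Poly_Mapping.lookup (moment_curve d t) l = (\<Sum>i<d. if i = l then t ^ Suc l else 0)"
    unfolding moment_curve_def lookup_sum
    by (intro sum.cong) (auto simp: lookup_single when_def)
  then show ?thesis by simp
qed

text \<open>
  A vector \<open>y\<close> is encoded by the polynomial \<open>t \<mapsto> \<langle>x(t) - c, y\<rangle>\<close>, where \<open>x(t)\<close> is the moment curve. The image
  consists of the polynomials of degree at most \<open>d\<close> in the kernel of a linear functional (the
  evaluation at \<open>c\<close>).
\<close>

definition vpoly :: "nat \<Rightarrow> (nat \<Rightarrow>\<^sub>0 real) \<Rightarrow> (nat \<Rightarrow>\<^sub>0 real) \<Rightarrow> real poly" where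
  "vpoly d c y = (\<Sum>l<d. monom (Poly_Mapping.lookup y l) (Suc l)) - [:dot d c y:]"

text \<open>The inverse encoding. It drops the constant coefficient, which is determined by the
  condition \<open>eval_at d c p = 0\<close>.\<close>

definition pvec :: "nat \<Rightarrow> real poly \<Rightarrow> (nat \<Rightarrow>\<^sub>0 real)" where
  "pvec d p = (\<Sum>l<d. Poly_Mapping.single l (poly.coeff p (Suc l)))"

text \<open>For \<open>p\<close> of degree at most \<open>d\<close>, this is the value at
  \<open>c\<close> of the affine function that restricts to \<open>p\<close> on the moment curve:
  \<open>t^(l+1)\<close> is replaced by coordinate \<open>l\<close> of \<open>c\<close>.\<close>

definition eval_at :: "nat \<Rightarrow> (nat \<Rightarrow>\<^sub>0 real) \<Rightarrow> real poly \<Rightarrow> real" where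
  "eval_at d c p = poly.coeff p 0 + (\<Sum>l<d. Poly_Mapping.lookup c l * poly.coeff p (Suc l))"

lemma lookup_pvec: "Poly_Mapping.lookup (pvec d p) l = (if l < d then poly.coeff p (Suc l) else 0)"
proof -
  have "Poly_Mapping.lookup (pvec d p) l = (\<Sum>i<d. if i = l then poly.coeff p (Suc l) else 0)"
    unfolding pvec_def lookup_sum by (intro sum.cong) (auto simp: lookup_single when_def)
  then show ?thesis by simp
qed

lemma pvec_in_Rn [simp]: "pvec d p \<in> Rn d"
  by (simp add: in_Rn_iff lookup_pvec)

lemma coeff_vpoly_0: "poly.coeff (vpoly d c y) 0 = - dot d c y"
  by (simp add: vpoly_def coeff_sum)

lemma coeff_vpoly_Suc:
  "poly.coeff (vpoly d c y) (Suc l) = (if l < d then Poly_Mapping.lookup y l else 0)"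
proof -
  have "poly.coeff (vpoly d c y) (Suc l) = (\<Sum>i<d. if i = l then Poly_Mapping.lookup y l else 0)"
    unfolding vpoly_def coeff_diff coeff_sum by (simp add: coeff_pCons)
  then show ?thesis by simp
qed

lemma degree_vpoly: "degree (vpoly d c y) \<le> d"
proof (rule degree_le, intro allI impI)
  fix i assume "d < i"
  then show "poly.coeff (vpoly d c y) i = 0" by (cases i) (simp_all add: coeff_vpoly_Suc)
qed

lemma poly_vpoly: "poly (vpoly d c y) t = dot d (moment_curve d t - c) y"
  by (simp add: vpoly_def poly_sum poly_monom dot_def lookup_minus lookup_moment_curve
      algebra_simps sum_subtractf cong: sum.cong_simp)

lemma vpoly_eq_iff:
  assumes "x \<in> Rn d" "y \<in> Rn d"
  shows "vpoly d c x = vpoly d c y \<longleftrightarrow> x = y"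
proof
  assume eq: "vpoly d c x = vpoly d c y"
  show "x = y"
  proof (rule poly_mapping_eqI)
    fix l
    show "Poly_Mapping.lookup x l = Poly_Mapping.lookup y l"
      using arg_cong[OF eq, of "\<lambda>p. poly.coeff p (Suc l)"] assms
      by (cases "l < d") (auto simp: coeff_vpoly_Suc in_Rn_iff)
  qed
qed simp

lemma vpoly_pvec:
  assumes "degree p \<le> d" "eval_at d c p = 0"
  shows "vpoly d c (pvec d p) = p"
proof (rule poly_eqI)
  fix i
  show "poly.coeff (vpoly d c (pvec d p)) i = poly.coeff p i"
  proof (cases i)
    case 0
    then show ?thesis using assms(2) by (simp add: coeff_vpoly_0 dot_def lookup_pvec eval_at_def cong: sum.cong_simp)
  next
    case (Suc l)
    then show ?thesis using assms(1) by (auto simp: coeff_vpoly_Suc lookup_pvec intro!: coeff_eq_0)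
  qed
qed

lemma eval_at_vpoly: "eval_at d c (vpoly d c y) = 0"
  by (simp add: eval_at_def coeff_vpoly_0 coeff_vpoly_Suc dot_def cong: sum.cong_simp)

lemma eval_at_diff: "eval_at d c (p - q) = eval_at d c p - eval_at d c q"
  by (simp add: eval_at_def right_diff_distrib sum_subtractf)

lemma eval_at_smult: "eval_at d c (smult r p) = r * eval_at d c p"
  by (simp add: eval_at_def distrib_left sum_distrib_left mult_ac)

lemma eval_at_1: "eval_at d c 1 = 1"
  by (simp add: eval_at_def)

section \<open>Polynomials with prescribed roots\<close>

definition root_poly :: "(nat \<Rightarrow> real) \<Rightarrow> nat set \<Rightarrow> real poly" where
  "root_poly t V = (\<Prod>i\<in>V. [:- t i, 1:])"

lemma poly_root_poly: "poly (root_poly t V) x = (\<Prod>i\<in>V. x - t i)"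
  by (simp add: root_poly_def poly_prod)

lemma degree_root_poly: "degree (root_poly t V) = card V"
  by (simp add: root_poly_def degree_prod_eq_sum_degree)

lemma lead_coeff_root_poly: "poly.coeff (root_poly t V) (card V) = 1"
  using lead_coeff_prod[of "\<lambda>i. [:- t i, 1:]" V] degree_root_poly[of t V]
  by (simp add: root_poly_def)

lemma root_poly_neq_0: "root_poly t V \<noteq> 0"
  using lead_coeff_root_poly[of t V] by auto

text \<open>Subtracting the multiple cancels the coefficient at \<open>card V\<close>. What remains
  has degree below \<open>card V\<close> but vanishes at \<open>card V\<close> points.\<close>

lemma eq_smult_root_poly:
  assumes "degree p \<le> card V" "inj_on t V" "finite V" "\<And>i. i \<in> V \<Longrightarrow> poly p (t i) = 0"
  shows "p = smult (poly.coeff p (card V)) (root_poly t V)"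
proof (rule ccontr)
  let ?q = "p - smult (poly.coeff p (card V)) (root_poly t V)"
  assume "p \<noteq> smult (poly.coeff p (card V)) (root_poly t V)"
  then have q: "?q \<noteq> 0" by simp
  have "t ` V \<subseteq> {x. poly ?q x = 0}"
    using assms(3,4) by (auto simp: poly_root_poly prod_zero_iff)
  then have "card (t ` V) \<le> card {x. poly ?q x = 0}"
    by (intro card_mono poly_roots_finite q)
  also have "\<dots> \<le> degree ?q" by (rule card_poly_roots_bound[OF q])
  finally have "card V \<le> degree ?q" using assms(2) by (simp add: card_image)
  moreover have "degree ?q \<le> card V"
    using assms(1) by (intro degree_diff_le) (auto simp: degree_root_poly)
  ultimately have "degree ?q = card V" by simp
  then have "lead_coeff ?q = poly.coeff ?q (card V)" by (rule arg_cong)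
  also have "\<dots> = 0" by (simp add: lead_coeff_root_poly)
  finally have "lead_coeff ?q = 0" .
  then show False using q leading_coeff_0_iff by blast
qed

section \<open>The polar as a simple polytope cut out by the nodes\<close>

text \<open>\<open>pos\<close> is the form in which the interior position of \<open>c\<close>
  enters: along every nonzero direction some node constraint increases.\<close>

locale moment_polar =
  fixes n d :: nat and t :: "nat \<Rightarrow> real" and c :: "nat \<Rightarrow>\<^sub>0 real"
  assumes mono: "strict_mono_on {..<n} t"
    and pos: "v \<in> Rn d \<Longrightarrow> v \<noteq> 0 \<Longrightarrow> \<exists>j<n. 0 < dot d (moment_curve d (t j) - c) v"
begin

definition con :: "nat \<Rightarrow> (nat \<Rightarrow>\<^sub>0 real) \<Rightarrow> real" where
  "con j y = dot d (moment_curve d (t j) - c) y"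

definition dcp :: "(nat \<Rightarrow>\<^sub>0 real) set" where
  "dcp = {y \<in> Rn d. \<forall>j\<in>{..<n}. con j y \<le> 1}"

abbreviation act :: "(nat \<Rightarrow>\<^sub>0 real) set \<Rightarrow> nat set" where
  "act \<equiv> active con (\<lambda>j. 1) {..<n}"

lemma linear_con: "linear (con j)"
  unfolding con_def by (rule linear_dot_right)

lemma con_eq_poly: "con j y = poly (vpoly d c y) (t j)"
  by (simp add: con_def poly_vpoly)

lemma inj_t: "V \<subseteq> {..<n} \<Longrightarrow> inj_on t V"
  using strict_mono_on_imp_inj_on[OF mono] inj_on_subset by blast

lemma finite_act [simp]: "finite (act F)"
  by (simp add: active_def)

lemma act_subset: "act F \<subseteq> {..<n}"
  by (auto simp: active_def)

text \<open>The evaluation at \<open>c\<close> is 0 on the image of \<open>vpoly\<close> but 1 on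
  the constant 1.\<close>

lemma vpoly_minus_1_neq_0: "vpoly d c y - 1 \<noteq> 0"
proof
  assume "vpoly d c y - 1 = 0"
  then have "eval_at d c (vpoly d c y - 1) = 0" by (simp add: eval_at_def)
  then show False by (simp add: eval_at_diff eval_at_vpoly eval_at_1)
qed

lemma degree_vpoly_minus_1: "degree (vpoly d c y - 1) \<le> d"
  by (intro degree_diff_le degree_vpoly) simp

text \<open>Tight nodes are roots of a nonzero polynomial of degree at most \<open>d\<close>. This
  is why the polar is simple.\<close>

lemma card_act_le: "card (act {y}) \<le> d"
proof -
  let ?p = "vpoly d c y - 1"
  have "card (act {y}) = card (t ` act {y})" by (simp add: card_image inj_t act_subset)
  also have "\<dots> \<le> card {x. poly ?p x = 0}"
    by (intro card_mono poly_roots_finite vpoly_minus_1_neq_0) (auto simp: active_def con_eq_poly)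
  also have "\<dots> \<le> degree ?p" by (rule card_poly_roots_bound[OF vpoly_minus_1_neq_0])
  finally show ?thesis using degree_vpoly_minus_1 by (rule order_trans)
qed

lemma ex_kernel_vector:
  assumes I: "I \<subseteq> {..<n}" "card I < d"
  shows "\<exists>v\<in>Rn d. v \<noteq> 0 \<and> (\<forall>i\<in>I. con i v = 0)"
proof -
  let ?r = "root_poly t I" and ?s = "pCons 0 (root_poly t I)"
  let ?L = "eval_at d c"
  have fin: "finite I" using I(1) finite_subset by blast
  \<comment> \<open>The root polynomial and its product with the variable both vanish at the nodes
    in \<open>I\<close> and have degree at most \<open>d\<close>; some nontrivial combination lies
    in the kernel of the evaluation at \<open>c\<close>.\<close>
  define p where "p = (if ?L ?r = 0 then ?r else smult (?L ?s) ?r - smult (?L ?r) ?s)"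
  have "?L p = 0" by (simp add: p_def eval_at_diff eval_at_smult del: smult_pCons)
  moreover have "degree p \<le> d"
    using I(2) by (auto simp: p_def degree_root_poly intro!: degree_diff_le order_trans[OF degree_smult_le]
        order_trans[OF degree_pCons_le])
  ultimately have vp: "vpoly d c (pvec d p) = p" by (intro vpoly_pvec)
  have "p \<noteq> 0"
  proof (cases "?L ?r = 0")
    case True
    then show ?thesis by (simp add: p_def root_poly_neq_0)
  next
    case False
    \<comment> \<open>Only the shifted polynomial reaches this degree, with leading coefficient
      1.\<close>
    then have "poly.coeff p (Suc (card I)) = - ?L ?r"
      by (simp add: p_def lead_coeff_root_poly coeff_eq_0 degree_root_poly)
    then show ?thesis using False by auto
  qed
  moreover have "vpoly d c 0 = 0" by (simp add: vpoly_def dot_def)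
  ultimately have "pvec d p \<noteq> 0" using vp by auto
  moreover have "con i (pvec d p) = 0" if "i \<in> I" for i
  proof -
    have "poly ?r (t i) = 0" using that fin by (auto simp: poly_root_poly)
    then have "poly p (t i) = 0" by (simp add: p_def)
    then show ?thesis by (simp add: con_eq_poly vp)
  qed
  ultimately show ?thesis using pvec_in_Rn by blast
qed

lemma subset_dcp: "F face_of dcp \<Longrightarrow> F \<subseteq> dcp"
  by (rule face_of_imp_subset)

lemma face_eq_act:
  assumes "F face_of dcp" "F \<noteq> {}"
  shows "F = {y \<in> dcp. \<forall>j\<in>act F. con j y = 1}"
  using face_eq_active[of "{..<n}" con "Rn d" dcp "\<lambda>_. 1" F] assms linear_con subspace_Rn
  by (simp add: dcp_def)

text \<open>Take a point of \<open>F\<close> with the most tight constraints. If there were fewer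
  than \<open>d\<close>, a direction preserving them could be followed until another constraint
  becomes tight, without leaving \<open>F\<close>.\<close>

lemma ex_vertex:
  assumes F: "F face_of dcp" "F \<noteq> {}"
  shows "\<exists>y\<in>F. card (act {y}) = d"
proof -
  define M where "M = Max ((\<lambda>y. card (act {y})) ` F)"
  have fin: "finite ((\<lambda>y. card (act {y})) ` F)"
    by (rule finite_subset[of _ "{..d}"]) (use card_act_le in auto)
  then have "M \<in> (\<lambda>y. card (act {y})) ` F" unfolding M_def using F(2) by (intro Max_in) auto
  then obtain y where y: "y \<in> F" "card (act {y}) = M" by auto
  have max: "card (act {z}) \<le> M" if "z \<in> F" for z
    unfolding M_def using fin that by (intro Max_ge) auto
  have "\<not> card (act {y}) < d"
  proof
    assume "card (act {y}) < d"
    then obtain v where v: "v \<in> Rn d" "v \<noteq> 0" "\<forall>i\<in>act {y}. con i v = 0"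
      using ex_kernel_vector[OF act_subset] by blast
    \<comment> \<open>The constraints that increase along \<open>v\<close>; by \<open>pos\<close>
      there is one. The ratio test below gives the longest step \<open>\<tau>\<close> that stays in
      \<open>dcp\<close>.\<close>
    define K where "K = {j \<in> {..<n}. 0 < con j v}"
    have K: "finite K" "K \<noteq> {}" using pos[OF v(1,2)] by (auto simp: K_def con_def)
    define \<rho> where "\<rho> = (\<lambda>j. (1 - con j y) / con j v)"
    define \<tau> where "\<tau> = Min (\<rho> ` K)"
    have "y \<in> dcp" using y F subset_dcp by blast
    then have yR: "y \<in> Rn d" and yc: "\<And>j. j < n \<Longrightarrow> con j y \<le> 1" by (auto simp: dcp_def)
    have "\<tau> \<in> \<rho> ` K" unfolding \<tau>_def using K by (intro Min_in) auto
    then obtain k where k: "k \<in> K" "\<tau> = \<rho> k" by auto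
    have \<tau>_le: "\<tau> \<le> \<rho> j" if "j \<in> K" for j unfolding \<tau>_def using K that by (intro Min_le) auto
    have "\<tau> \<ge> 0" using k yc by (auto simp: \<rho>_def K_def)
    define z where "z = y + \<tau> *\<^sub>R v"
    have cz: "con j z = con j y + \<tau> * con j v" for j
      by (simp add: z_def linear_add[OF linear_con] linear_scale[OF linear_con])
    have "con j z \<le> 1" if j: "j < n" for j
    proof (cases "0 < con j v")
      case True
      then have "\<tau> \<le> (1 - con j y) / con j v" using \<tau>_le[of j] j by (simp add: K_def \<rho>_def)
      then show ?thesis using True by (simp add: cz field_simps)
    next
      case False
      then have "\<tau> * con j v \<le> 0" using \<open>\<tau> \<ge> 0\<close> by (simp add: mult_nonneg_nonpos)
      then show ?thesis using yc[OF j] by (simp add: cz)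
    qed
    moreover have "z \<in> Rn d" unfolding z_def
      using yR v subspace_Rn by (intro subspace_add subspace_scale)
    ultimately have "z \<in> dcp" by (simp add: dcp_def)
    have sub: "act {y} \<subseteq> act {z}" using v(3) by (auto simp: active_def cz)
    \<comment> \<open>The moved point stays in \<open>F\<close>, since \<open>F\<close> is cut out
      of \<open>dcp\<close> by constraints that were already tight at \<open>y\<close>.\<close>
    have "act F \<subseteq> act {y}" using y by (auto simp: active_def)
    then have "con j z = 1" if "j \<in> act F" for j using sub that by (auto simp: active_def)
    then have "z \<in> F" using \<open>z \<in> dcp\<close> face_eq_act[OF F] by blast
    have "con k v > 0" "k < n" using k by (auto simp: K_def)
    then have "con k z = 1" using k by (simp add: cz \<rho>_def)
    then have "k \<in> act {z}" using \<open>k < n\<close> by (simp add: active_def)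
    moreover have "k \<notin> act {y}" using v(3) \<open>con k v > 0\<close> by auto
    ultimately have "act {y} \<subset> act {z}" using sub by blast
    then have "card (act {y}) < card (act {z})" by (intro psubset_card_mono) auto
    then show False using max[OF \<open>z \<in> F\<close>] y by simp
  qed
  then show ?thesis using y card_act_le[of y] by force
qed

lemma vertex_poly:
  assumes "card (act {y}) = d"
  shows "\<exists>\<alpha>. \<alpha> \<noteq> 0 \<and> vpoly d c y - 1 = smult \<alpha> (root_poly t (act {y}))"
proof -
  let ?p = "vpoly d c y - 1"
  have "poly ?p (t i) = 0" if "i \<in> act {y}" for i
    using that by (simp add: active_def con_eq_poly)
  then have "?p = smult (poly.coeff ?p d) (root_poly t (act {y}))"
    using eq_smult_root_poly[OF _ inj_t[OF act_subset] finite_act, of ?p "{y}"] degree_vpoly_minus_1 assms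
    by metis
  moreover from this have "poly.coeff ?p d \<noteq> 0" using vpoly_minus_1_neq_0 by (metis smult_0_left)
  ultimately show ?thesis by blast
qed

text \<open>The \<open>d\<close> functionals tight at a vertex of \<open>F\<close> have a dual basis
  built from Lagrange-type polynomials, so each constraint active on \<open>F\<close> lowers the
  dimension by exactly one.\<close>

lemma affine_dim_dcp_face:
  assumes F: "F face_of dcp" "F \<noteq> {}"
  shows "affine_dim F + card (act F) = d"
proof -
  obtain y where y: "y \<in> F" "card (act {y}) = d" using ex_vertex[OF F] by blast
  let ?V = "act {y}" and ?L = "eval_at d c"
  have IV: "act F \<subseteq> ?V" using y by (auto simp: active_def)
  obtain \<alpha> where \<alpha>: "\<alpha> \<noteq> 0" "vpoly d c y - 1 = smult \<alpha> (root_poly t ?V)"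
    using vertex_poly[OF y(2)] by blast
  \<comment> \<open>Hence the root polynomial of the vertex is outside the kernel of the evaluation,
    and its value can be divided by.\<close>
  have "?L (vpoly d c y - 1) = - 1" by (simp add: eval_at_diff eval_at_vpoly eval_at_1)
  then have LV: "?L (root_poly t ?V) \<noteq> 0" unfolding \<alpha>(2) eval_at_smult by auto
  \<comment> \<open>Omitting the root \<open>t j\<close> gives a polynomial that is nonzero only at
    node \<open>j\<close> of the vertex. The correction moves it into the kernel of the evaluation
    and vanishes at all these nodes.\<close>
  define r where "r j = root_poly t (?V - {j}) - smult (?L (root_poly t (?V - {j})) / ?L (root_poly t ?V)) (root_poly t ?V)" for j
  define w where "w j = pvec d (r j)" for j
  have vw: "vpoly d c (w j) = r j" for j unfolding w_def
  proof (rule vpoly_pvec)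
    show "degree (r j) \<le> d" unfolding r_def
      using y(2) card_Diff1_le[of ?V j]
      by (intro degree_diff_le order_trans[OF degree_smult_le]) (auto simp: degree_root_poly)
    show "?L (r j) = 0" using LV by (simp add: r_def eval_at_diff eval_at_smult)
  qed
  have root: "poly (root_poly t ?V) (t i) = 0" if "i \<in> ?V" for i
    using that by (auto simp: poly_root_poly)
  have "affine_dim F = dim {v \<in> Rn d. \<forall>j\<in>act F. con j v = 0}"
    using affine_dim_face[of "{..<n}" con "Rn d" dcp "\<lambda>_. 1" F] F linear_con subspace_Rn
    by (simp add: dcp_def)
  also have "\<dots> = card (?V - act F)"
  proof (rule dim_kernel_dual_basis)
    show "finite ?V" "act F \<subseteq> ?V" "subspace (Rn d)" using IV subspace_Rn by auto
    show "linear (con j)" for j by (rule linear_con)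
    show "w j \<in> Rn d" for j by (simp add: w_def)
    show "con j (w j) \<noteq> 0" if "j \<in> ?V" for j
    proof -
      have "t j \<noteq> t i" if "i \<in> ?V - {j}" for i
        using that \<open>j \<in> ?V\<close> inj_t[OF act_subset, of "{y}"] by (auto dest: inj_onD)
      then have "poly (root_poly t (?V - {j})) (t j) \<noteq> 0" by (auto simp: poly_root_poly)
      then show ?thesis using root[OF that] by (simp add: con_eq_poly vw r_def)
    qed
    show "con i (w j) = 0" if "i \<in> ?V" "j \<in> ?V" "i \<noteq> j" for i j
    proof -
      have "poly (root_poly t (?V - {j})) (t i) = 0" using that by (auto simp: poly_root_poly)
      then show ?thesis using root[OF that(1)] by (simp add: con_eq_poly vw r_def)
    qed
    \<comment> \<open>A vector killed at all \<open>d\<close> nodes is encoded by a multiple of the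
      root polynomial, and the evaluation at \<open>c\<close> forces the factor to be 0.\<close>
    show "v = 0" if v: "v \<in> Rn d" and z: "\<And>i. i \<in> ?V \<Longrightarrow> con i v = 0" for v
    proof -
      have "degree (vpoly d c v) \<le> card ?V" using y(2) degree_vpoly by simp
      then have e: "vpoly d c v = smult (poly.coeff (vpoly d c v) d) (root_poly t ?V)"
        using eq_smult_root_poly[of "vpoly d c v" ?V t] inj_t[OF act_subset] z y(2)
        by (simp add: con_eq_poly)
      have "?L (vpoly d c v) = 0" by (rule eval_at_vpoly)
      then have "poly.coeff (vpoly d c v) d = 0"
        using LV by (subst (asm) e) (simp add: eval_at_smult)
      then have "vpoly d c v = 0" using e by simp
      also have "\<dots> = vpoly d c 0" by (simp add: vpoly_def dot_def)
      finally show ?thesis using vpoly_eq_iff v subspace_0[OF subspace_Rn] by blast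
    qed
  qed
  finally show ?thesis using IV y(2) card_mono[OF _ IV] by (simp add: card_Diff_subset)
qed

text \<open>The polynomial of a vertex has no sign changes at the nodes outside of its \<open>d\<close> roots.\<close>

lemma vertex_parity:
  assumes y: "y \<in> dcp" "card (act {y}) = d"
    and ij: "i \<in> {..<n} - act {y}" "j \<in> {..<n} - act {y}"
  shows "even (card {l \<in> act {y}. i < l}) = even (card {l \<in> act {y}. j < l})"
proof -
  obtain \<alpha> where \<alpha>: "\<alpha> \<noteq> 0" "vpoly d c y - 1 = smult \<alpha> (root_poly t (act {y}))"
    using vertex_poly[OF y(2)] by blast
  \<comment> \<open>Feasibility makes the polynomial negative at every node outside the active set.
    Its factor \<open>t i - t l\<close> is negative exactly for \<open>l > i\<close>, so the parity
    is fixed by the sign of \<open>\<alpha>\<close> alone.\<close>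
  have "even (card {l \<in> act {y}. i < l}) \<longleftrightarrow> \<alpha> < 0" if i: "i \<in> {..<n} - act {y}" for i
  proof -
    have "poly (vpoly d c y - 1) (t i) < 0"
      using y(1) i by (auto simp: active_def dcp_def con_eq_poly order_less_le)
    then have neg: "\<alpha> * (\<Prod>l\<in>act {y}. t i - t l) < 0" unfolding \<alpha>(2) by (simp add: poly_root_poly)
    have lt: "t l < t m" if "l < m" "l < n" "m < n" for l m
      using that mono by (auto simp: strict_mono_on_def)
    have "(\<Prod>l\<in>act {y}. t i - t l) = (\<Prod>l\<in>act {y}. (if i < l then - 1 else 1) * \<bar>t i - t l\<bar>)"
    proof (intro prod.cong refl)
      fix l assume l: "l \<in> act {y}"
      then have "l \<noteq> i" "l < n" "i < n" using i by (auto simp: active_def)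
      then show "t i - t l = (if i < l then - 1 else 1) * \<bar>t i - t l\<bar>"
        using lt[of i l] lt[of l i] by (cases "i < l") auto
    qed
    also have "\<dots> = (\<Prod>l\<in>act {y}. if i < l then - 1 else 1) * (\<Prod>l\<in>act {y}. \<bar>t i - t l\<bar>)"
      by (rule prod.distrib)
    also have "(\<Prod>l\<in>act {y}. if i < l then - 1 else (1::real)) = (- 1) ^ card {l \<in> act {y}. i < l}"
      by (simp add: prod.If_cases Int_def)
    finally have e: "(\<Prod>l\<in>act {y}. t i - t l) = (- 1) ^ card {l \<in> act {y}. i < l} * (\<Prod>l\<in>act {y}. \<bar>t i - t l\<bar>)" .
    have "t i \<noteq> t l" if "l \<in> act {y}" for l
      using that i lt[of i l] lt[of l i] by (cases i l rule: linorder_cases) (auto simp: active_def)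
    then have "0 < (\<Prod>l\<in>act {y}. \<bar>t i - t l\<bar>)" by (intro prod_pos) auto
    then show ?thesis using neg unfolding e
      by (cases "even (card {l \<in> act {y}. i < l})") (auto simp: mult_less_0_iff zero_less_mult_iff)
  qed
  then show ?thesis using ij by blast
qed

end

section \<open>Faces of direct sums\<close>


text \<open>Includes the degenerate case \<open>a = b\<close>, which open segments exclude but which
  arises when only one component of a direct sum varies.\<close>

lemma face_ofD_convex_comb:
  fixes a b :: "'a::real_vector"
  assumes "F face_of S" "a \<in> S" "b \<in> S" "0 < r" "r < 1" "(1 - r) *\<^sub>R a + r *\<^sub>R b \<in> F"
  shows "a \<in> F \<and> b \<in> F"
proof (cases "a = b")
  case True
  then show ?thesis using assms(6) by (simp add: scaleR_left_diff_distrib)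
next
  case False
  then have "(1 - r) *\<^sub>R a + r *\<^sub>R b \<in> open_segment a b"
    using assms(4,5) by (auto simp: in_segment)
  then show ?thesis using assms unfolding face_of_def by blast
qed

lemma face_ofI_convex_comb:
  fixes S :: "'a::real_vector set"
  assumes "F \<subseteq> S" "convex F"
    and "\<And>a b r. a \<in> S \<Longrightarrow> b \<in> S \<Longrightarrow> 0 < r \<Longrightarrow> r < 1 \<Longrightarrow> (1 - r) *\<^sub>R a + r *\<^sub>R b \<in> F \<Longrightarrow> a \<in> F \<and> b \<in> F"
  shows "F face_of S"
  using assms unfolding face_of_def in_segment by blast

text \<open>Codimension is the index that matches the exponents of the generating polynomials and
  adds up in direct sums. The equation with a sum avoids truncated subtraction.\<close>

definition faces_codim :: "nat \<Rightarrow> nat \<Rightarrow> 'a::real_vector set \<Rightarrow> 'a set set" where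
  "faces_codim D s P = {F. F face_of P \<and> F \<noteq> {} \<and> affine_dim F + s = D}"

lemma fnum_eq_card_faces_codim: "k + s = D \<Longrightarrow> fnum k P = card (faces_codim D s P)"
  by (auto simp: fnum_def faces_codim_def intro!: arg_cong[of _ _ card])

text \<open>\<open>zero\<close> makes \<open>e\<close> injective and its range meet \<open>U\<close>
  only in 0. The finite set \<open>W\<close> keeps bases inside \<open>U\<close> finite, so that
  dimensions can be added.\<close>

locale direct_sum =
  fixes e :: "'b::euclidean_space \<Rightarrow> 'a::real_vector" and U W :: "'a set"
  assumes lin: "linear e" and U: "subspace U" "U \<subseteq> span W" "finite W"
    and zero: "e z \<in> U \<Longrightarrow> z = 0"
begin

definition dsum :: "'a set \<Rightarrow> 'b set \<Rightarrow> 'a set" where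
  "dsum S G = {u + e z | u z. u \<in> S \<and> z \<in> G}"

lemma dsumI: "u \<in> S \<Longrightarrow> z \<in> G \<Longrightarrow> u + e z \<in> dsum S G"
  by (auto simp: dsum_def)

lemma dsum_unique:
  assumes "u + e z = u' + e z'" "u \<in> U" "u' \<in> U"
  shows "u = u' \<and> z = z'"
proof -
  have "e (z - z') = u' - u" using assms(1) lin by (simp add: linear_diff algebra_simps)
  then have "e (z - z') \<in> U" using U(1) assms by (simp add: subspace_diff)
  then have "z = z'" using zero by fastforce
  then show ?thesis using assms(1) by simp
qed

lemma dsum_mem_iff: "S \<subseteq> U \<Longrightarrow> u \<in> U \<Longrightarrow> u + e z \<in> dsum S G \<longleftrightarrow> u \<in> S \<and> z \<in> G"
  unfolding dsum_def using dsum_unique by blast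

lemma dsum_memD:
  "S \<subseteq> U \<Longrightarrow> u \<in> U \<Longrightarrow> C \<subseteq> dsum S G \<Longrightarrow> u + e z \<in> C \<Longrightarrow> u \<in> S \<and> z \<in> G"
  using dsum_mem_iff by blast

lemma dsum_comb:
  "(1 - r) *\<^sub>R (u + e z) + r *\<^sub>R (u' + e z') =
     ((1 - r) *\<^sub>R u + r *\<^sub>R u') + e ((1 - r) *\<^sub>R z + r *\<^sub>R z')"
  unfolding linear_add[OF lin] linear_scale[OF lin] by (simp add: algebra_simps)

lemma comb_in_U: "u \<in> U \<Longrightarrow> u' \<in> U \<Longrightarrow> (1 - r) *\<^sub>R u + r *\<^sub>R u' \<in> U"
  using U(1) by (intro subspace_add subspace_scale)

lemma convex_dsum:
  assumes "convex S" "convex G"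
  shows "convex (dsum S G)"
  unfolding convex_alt
proof clarify
  fix x y and r :: real assume "x \<in> dsum S G" "y \<in> dsum S G" and r: "0 \<le> r" "r \<le> 1"
  then obtain u z u' z' where uz: "x = u + e z" "u \<in> S" "z \<in> G" "y = u' + e z'" "u' \<in> S" "z' \<in> G"
    by (auto simp: dsum_def)
  show "(1 - r) *\<^sub>R x + r *\<^sub>R y \<in> dsum S G"
    unfolding uz dsum_comb by (intro dsumI) (use assms uz r in \<open>auto simp: convex_alt\<close>)
qed

lemma face_of_dsum:
  assumes "S \<subseteq> U" "F face_of S" "H face_of G"
  shows "dsum F H face_of dsum S G"
proof (rule face_ofI_convex_comb)
  have sub: "F \<subseteq> S" "H \<subseteq> G" using assms face_of_imp_subset by auto
  show "dsum F H \<subseteq> dsum S G" using sub by (auto simp: dsum_def)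
  show "convex (dsum F H)" using assms by (intro convex_dsum) (auto dest: face_of_imp_convex)
  fix a b and r :: real
  assume ab: "a \<in> dsum S G" "b \<in> dsum S G" and r: "0 < r" "r < 1" and m: "(1 - r) *\<^sub>R a + r *\<^sub>R b \<in> dsum F H"
  obtain u z u' z' where uz: "a = u + e z" "u \<in> S" "z \<in> G" "b = u' + e z'" "u' \<in> S" "z' \<in> G"
    using ab by (auto simp: dsum_def)
  have "(1 - r) *\<^sub>R u + r *\<^sub>R u' \<in> U" using uz assms(1) by (intro comb_in_U) auto
  moreover have "F \<subseteq> U" using sub assms(1) by auto
  ultimately have "(1 - r) *\<^sub>R u + r *\<^sub>R u' \<in> F" "(1 - r) *\<^sub>R z + r *\<^sub>R z' \<in> H"
    using m unfolding uz dsum_comb by (auto simp: dsum_mem_iff)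
  then have "u \<in> F \<and> u' \<in> F" "z \<in> H \<and> z' \<in> H"
    using face_ofD_convex_comb[OF assms(2) uz(2,5) r] face_ofD_convex_comb[OF assms(3) uz(3,6) r] by auto
  then show "a \<in> dsum F H \<and> b \<in> dsum F H" using uz by (auto intro: dsumI)
qed

text \<open>The summands are the two projections of \<open>C\<close>. That \<open>C\<close> contains
  every sum of projected points follows by exchanging components of two of its points.\<close>

lemma face_of_dsum_decomp:
  assumes S: "S \<subseteq> U" and C: "C face_of dsum S G"
  shows "\<exists>F H. F face_of S \<and> H face_of G \<and> C = dsum F H"
proof -
  define F where "F = {u \<in> S. \<exists>z\<in>G. u + e z \<in> C}"
  define H where "H = {z \<in> G. \<exists>u\<in>S. u + e z \<in> C}"
  have conv: "convex C" using C face_of_imp_convex by blast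
  have sub: "C \<subseteq> dsum S G" using C face_of_imp_subset by blast
  have cross: "u \<in> S \<and> u' \<in> S \<and> z \<in> G \<and> z' \<in> G \<and> u + e z' \<in> C"
    if "u + e z \<in> C" "u' + e z' \<in> C" "u \<in> U" "u' \<in> U" for u z u' z'
  proof -
    have mem: "u \<in> S" "u' \<in> S" "z \<in> G" "z' \<in> G"
      using dsum_memD[OF S that(3) sub that(1)] dsum_memD[OF S that(4) sub that(2)] by auto
    have "(1 - 1/2) *\<^sub>R (u + e z) + (1/2) *\<^sub>R (u' + e z') \<in> C"
      using conv that unfolding convex_alt by (metis divide_le_eq_1 le_numeral_extra(3) one_le_numeral
          zero_le_divide_1_iff zero_le_numeral zero_less_numeral)
    \<comment> \<open>This midpoint is also the midpoint of the two points with exchanged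
      components; the face property puts these into \<open>C\<close>.\<close>
    also have "(1 - 1/2) *\<^sub>R (u + e z) + (1/2) *\<^sub>R (u' + e z') =
       (1 - 1/2) *\<^sub>R (u + e z') + (1/2::real) *\<^sub>R (u' + e z)"
      by (simp add: algebra_simps)
    finally have "u + e z' \<in> C"
      using face_ofD_convex_comb[OF C, of "u + e z'" "u' + e z" "1/2"] mem by (auto intro: dsumI)
    then show ?thesis using mem by simp
  qed
  have "F face_of S"
  proof (rule face_ofI_convex_comb)
    show "F \<subseteq> S" by (auto simp: F_def)
    show "convex F" unfolding convex_alt
    proof clarify
      fix u u' and r :: real assume "u \<in> F" "u' \<in> F" and r: "0 \<le> r" "r \<le> 1"
      then obtain z z' where uz: "u \<in> S" "z \<in> G" "u + e z \<in> C" "u' \<in> S" "z' \<in> G" "u' + e z' \<in> C"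
        by (auto simp: F_def)
      have "(1 - r) *\<^sub>R (u + e z) + r *\<^sub>R (u' + e z') \<in> C" using conv uz r by (simp add: convex_alt)
      then have c: "((1 - r) *\<^sub>R u + r *\<^sub>R u') + e ((1 - r) *\<^sub>R z + r *\<^sub>R z') \<in> C" unfolding dsum_comb .
      have "(1 - r) *\<^sub>R u + r *\<^sub>R u' \<in> U" using uz S by (intro comb_in_U) auto
      then have "(1 - r) *\<^sub>R u + r *\<^sub>R u' \<in> S" "(1 - r) *\<^sub>R z + r *\<^sub>R z' \<in> G"
        using dsum_memD[OF S _ sub c] by auto
      then show "(1 - r) *\<^sub>R u + r *\<^sub>R u' \<in> F" using c by (auto simp: F_def)
    qed
    fix a b and r :: real
    assume ab: "a \<in> S" "b \<in> S" and r: "0 < r" "r < 1" and "(1 - r) *\<^sub>R a + r *\<^sub>R b \<in> F"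
    then obtain z where z: "z \<in> G" "((1 - r) *\<^sub>R a + r *\<^sub>R b) + e z \<in> C" by (auto simp: F_def)
    have "((1 - r) *\<^sub>R a + r *\<^sub>R b) + e z = (1 - r) *\<^sub>R (a + e z) + r *\<^sub>R (b + e z)"
      by (simp add: algebra_simps)
    then have "a + e z \<in> C \<and> b + e z \<in> C"
      using face_ofD_convex_comb[OF C _ _ r, of "a + e z" "b + e z"] ab z by (simp add: dsumI)
    then show "a \<in> F \<and> b \<in> F" using ab z by (auto simp: F_def)
  qed
  moreover have "H face_of G"
  proof (rule face_ofI_convex_comb)
    show "H \<subseteq> G" by (auto simp: H_def)
    show "convex H" unfolding convex_alt
    proof clarify
      fix z z' and r :: real assume "z \<in> H" "z' \<in> H" and r: "0 \<le> r" "r \<le> 1"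
      then obtain u u' where uz: "u \<in> S" "z \<in> G" "u + e z \<in> C" "u' \<in> S" "z' \<in> G" "u' + e z' \<in> C"
        by (auto simp: H_def)
      have "(1 - r) *\<^sub>R (u + e z) + r *\<^sub>R (u' + e z') \<in> C" using conv uz r by (simp add: convex_alt)
      then have c: "((1 - r) *\<^sub>R u + r *\<^sub>R u') + e ((1 - r) *\<^sub>R z + r *\<^sub>R z') \<in> C" unfolding dsum_comb .
      have "(1 - r) *\<^sub>R u + r *\<^sub>R u' \<in> U" using uz S by (intro comb_in_U) auto
      then have "(1 - r) *\<^sub>R u + r *\<^sub>R u' \<in> S" "(1 - r) *\<^sub>R z + r *\<^sub>R z' \<in> G"
        using dsum_memD[OF S _ sub c] by auto
      then show "(1 - r) *\<^sub>R z + r *\<^sub>R z' \<in> H" using c by (auto simp: H_def)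
    qed
    fix a b and r :: real
    assume ab: "a \<in> G" "b \<in> G" and r: "0 < r" "r < 1" and "(1 - r) *\<^sub>R a + r *\<^sub>R b \<in> H"
    then obtain u where u: "u \<in> S" "u + e ((1 - r) *\<^sub>R a + r *\<^sub>R b) \<in> C" by (auto simp: H_def)
    have "u + e ((1 - r) *\<^sub>R a + r *\<^sub>R b) = (1 - r) *\<^sub>R (u + e a) + r *\<^sub>R (u + e b)"
      unfolding dsum_comb by (simp add: algebra_simps)
    then have "u + e a \<in> C \<and> u + e b \<in> C"
      using face_ofD_convex_comb[OF C _ _ r, of "u + e a" "u + e b"] ab u by (simp add: dsumI)
    then show "a \<in> H \<and> b \<in> H" using ab u by (auto simp: H_def)
  qed
  moreover have "C = dsum F H"
  proof
    show "C \<subseteq> dsum F H"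
    proof
      fix x assume "x \<in> C"
      then obtain u z where "x = u + e z" "u \<in> S" "z \<in> G" using sub by (auto simp: dsum_def)
      then show "x \<in> dsum F H" using \<open>x \<in> C\<close> by (auto simp: F_def H_def intro!: dsumI)
    qed
    show "dsum F H \<subseteq> C"
    proof
      fix x assume "x \<in> dsum F H"
      then obtain u z u' z' where "x = u + e z'" "u \<in> S" "u + e z \<in> C" "u' \<in> S" "u' + e z' \<in> C"
        by (auto simp: dsum_def F_def H_def)
      then show "x \<in> C" using cross S by blast
    qed
  qed
  ultimately show ?thesis by blast
qed

text \<open>Finiteness matters for lower bounds on face numbers, since \<open>card\<close> of an
  infinite set is 0.\<close>

lemma finite_faces_dsum:
  assumes "S \<subseteq> U" "finite {F. F face_of S}" "finite {H. H face_of G}"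
  shows "finite {C. C face_of dsum S G}"
proof (rule finite_subset)
  show "{C. C face_of dsum S G} \<subseteq> (\<lambda>(F, H). dsum F H) ` ({F. F face_of S} \<times> {H. H face_of G})"
    using face_of_dsum_decomp[OF assms(1)] by auto
  show "finite ((\<lambda>(F, H). dsum F H) ` ({F. F face_of S} \<times> {H. H face_of G}))"
    using assms by simp
qed

lemma dsum_eq_iff:
  assumes "F \<subseteq> U" "F' \<subseteq> U" "F \<noteq> {}" "H \<noteq> {}" "F' \<noteq> {}" "H' \<noteq> {}"
  shows "dsum F H = dsum F' H' \<longleftrightarrow> F = F' \<and> H = H'"
proof
  assume eq: "dsum F H = dsum F' H'"
  have *: "u \<in> F \<and> z \<in> H \<longleftrightarrow> u \<in> F' \<and> z \<in> H'" if "u \<in> U" for u z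
    using dsum_mem_iff[OF assms(1) that, of z H] dsum_mem_iff[OF assms(2) that, of z H'] eq by simp
  obtain u0 z0 where "u0 \<in> F" "z0 \<in> H" using assms by auto
  then have "u0 \<in> F'" "z0 \<in> H'" using *[of u0 z0] assms by auto
  show "F = F' \<and> H = H'"
    using * \<open>u0 \<in> F\<close> \<open>z0 \<in> H\<close> \<open>u0 \<in> F'\<close> \<open>z0 \<in> H'\<close> assms(1,2) by blast
qed simp

text \<open>A basis of \<open>S\<close> and the image of a basis of \<open>G\<close> together form a
  basis. Containing 0 on both sides ensures that these vectors themselves belong to the sum.\<close>

lemma dim_dsum:
  assumes S: "S \<subseteq> U" "0 \<in> S" "0 \<in> G"
  shows "dim (dsum S G) = dim S + dim G"
proof -
  obtain B where B: "B \<subseteq> S" "independent B" "S \<subseteq> span B" "card B = dim S"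
    using basis_exists[of S] by blast
  obtain C where C: "C \<subseteq> G" "independent C" "G \<subseteq> span C" "card C = dim G"
    using basis_exists[of G] by blast
  have "B \<subseteq> span W" using B S U by blast
  then have finB: "finite B" using independent_span_bound[OF U(3) B(2)] by simp
  have finC: "finite C" using C(2) by (rule finiteI_independent)
  have BU: "B \<subseteq> U" using B S by auto
  have e0: "e 0 = 0" using lin by (rule linear_0)
  have inj: "inj e"
    unfolding linear_injective_0[OF lin] using zero subspace_0[OF U(1)] by metis
  have indC: "independent (e ` C)"
    using C(2) lin inj by (simp add: linear_independent_injective_image inj_on_subset)
  have disj: "B \<inter> e ` C = {}"
  proof -
    have False if "c \<in> C" "e c \<in> B" for c
    proof -
      have "c = 0" using zero that BU by blast
      then show False using C(2) that dependent_zero by blast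
    qed
    then show ?thesis by blast
  qed
  show ?thesis
  proof (rule dim_unique)
    show "B \<union> e ` C \<subseteq> dsum S G"
    proof
      fix x assume "x \<in> B \<union> e ` C"
      then consider "x \<in> S" | z where "z \<in> G" "x = e z" using B C by auto
      then show "x \<in> dsum S G"
        by cases (use dsumI[of x S 0 G] dsumI[of 0 S _ G] S e0 in auto)
    qed
    show "dsum S G \<subseteq> span (B \<union> e ` C)"
    proof
      fix x assume "x \<in> dsum S G"
      then obtain u z where x: "x = u + e z" "u \<in> S" "z \<in> G" by (auto simp: dsum_def)
      have "u \<in> span (B \<union> e ` C)" using x B span_mono[of B "B \<union> e ` C"] by blast
      moreover have "e z \<in> span (e ` C)" using x C linear_span_image[OF lin] by blast
      then have "e z \<in> span (B \<union> e ` C)" using span_mono[of "e ` C" "B \<union> e ` C"] by blast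
      ultimately show "x \<in> span (B \<union> e ` C)" unfolding x by (rule span_add)
    qed
    show "card (B \<union> e ` C) = dim S + dim G"
      using finB finC disj B C inj by (simp add: card_Un_disjoint card_image inj_on_subset)
    have "f v = 0" if s: "(\<Sum>v\<in>B \<union> e ` C. f v *\<^sub>R v) = 0" and v: "v \<in> B \<union> e ` C" for f v
    proof -
      let ?b = "\<Sum>v\<in>B. f v *\<^sub>R v" and ?c = "\<Sum>c\<in>C. f (e c) *\<^sub>R c"
      have ec: "(\<Sum>v\<in>e ` C. f v *\<^sub>R v) = e ?c"
        using inj_on_subset[OF inj] lin by (subst sum.reindex) (auto simp: linear_sum linear_scale)
      have "?b + (\<Sum>v\<in>e ` C. f v *\<^sub>R v) = 0"
        using s finB finC disj by (simp add: sum.union_disjoint)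
      then have "?b + e ?c = 0 + e 0" by (simp add: ec e0)
      moreover have "?b \<in> U" using BU U by (intro subspace_sum subspace_scale) auto
      moreover have "0 \<in> U" using U by (simp add: subspace_0)
      ultimately have "?b = 0" "?c = 0" using dsum_unique by blast+
      then have "(\<Sum>v\<in>e ` C. f v *\<^sub>R v) = 0" by (simp add: ec e0)
      then show ?thesis
        using v \<open>?b = 0\<close> B(2) indC finB finC by (auto simp: dependent_finite)
    qed
    then show "independent (B \<union> e ` C)"
      using finB finC by (auto simp: dependent_finite)
  qed
qed

lemma affine_dim_dsum:
  assumes "F \<subseteq> U" "F \<noteq> {}" "H \<noteq> {}"
  shows "affine_dim (dsum F H) = affine_dim F + affine_dim H"
proof -
  let ?D = "\<lambda>S. {x - y | x y. x \<in> S \<and> y \<in> S}"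
  have "?D (dsum F H) = dsum (?D F) {x - y | x y. x \<in> H \<and> y \<in> H}" (is "?l = ?r")
  proof
    show "?l \<subseteq> ?r"
    proof
      fix x assume "x \<in> ?l"
      then obtain u z u' z' where x: "x = (u + e z) - (u' + e z')" "u \<in> F" "u' \<in> F" "z \<in> H" "z' \<in> H"
        by (auto simp: dsum_def)
      then have xe: "x = (u - u') + e (z - z')" using lin by (simp add: linear_diff)
      show "x \<in> ?r" unfolding xe by (intro dsumI) (use x in blast)+
    qed
    show "?r \<subseteq> ?l"
    proof
      fix x assume "x \<in> ?r"
      then obtain u z u' z' where x: "x = (u - u') + e (z - z')" "u \<in> F" "u' \<in> F" "z \<in> H" "z' \<in> H"
        by (auto simp: dsum_def)
      then have "x = (u + e z) - (u' + e z')" using lin by (simp add: linear_diff)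
      then show "x \<in> ?l" using x dsumI by blast
    qed
  qed
  moreover have "?D F \<subseteq> U" using assms U by (auto intro!: subspace_diff)
  moreover have "0 \<in> ?D F" "0 \<in> {x - y | x y. x \<in> H \<and> y \<in> H}" using assms by fastforce+
  ultimately show ?thesis unfolding affine_dim_def by (simp add: dim_dsum)
qed

text \<open>The coefficient of a product is a convolution, and so is the count of sums of faces by
  codimension. Distinct pairs of nonempty faces have distinct sums, so lower bounds multiply as
  polynomials.\<close>

lemma coeff_mult_le_card_faces_codim:
  assumes S: "S \<subseteq> U" "finite {F. F face_of S}" "finite {H. H face_of G}"
    and p: "\<And>i. poly.coeff p i \<le> card (faces_codim D i S)"
    and q: "\<And>i. poly.coeff q i \<le> card (faces_codim E i G)"
  shows "poly.coeff (p * q) s \<le> card (faces_codim (D + E) s (dsum S G))"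
proof -
  define M where "M = (SIGMA i:{..s}. faces_codim D i S \<times> faces_codim E (s - i) G)"
  have fin: "finite (faces_codim D i S)" "finite (faces_codim E i G)" for i
    using S(2,3) by (auto simp: faces_codim_def)
  have "poly.coeff (p * q) s \<le> (\<Sum>i\<le>s. card (faces_codim D i S) * card (faces_codim E (s - i) G))"
    unfolding coeff_mult by (intro sum_mono mult_mono p q) auto
  also have "\<dots> = card M" unfolding M_def using fin by (simp add: card_SigmaI card_cartesian_product)
  also have "\<dots> = card ((\<lambda>(i, F, H). dsum F H) ` M)"
  proof (rule card_image[symmetric], rule inj_onI)
    fix x y assume "x \<in> M" "y \<in> M" and eq: "(case x of (i, F, H) \<Rightarrow> dsum F H) = (case y of (i, F, H) \<Rightarrow> dsum F H)"
    obtain i F H i' F' H' where x: "x = (i, F, H)" and y: "y = (i', F', H')"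
      by (cases x, cases y) auto
    have F: "F face_of S" "F \<noteq> {}" "affine_dim F + i = D" "H \<noteq> {}"
      using \<open>x \<in> M\<close> by (auto simp: x M_def faces_codim_def)
    have F': "F' face_of S" "F' \<noteq> {}" "affine_dim F' + i' = D" "H' \<noteq> {}"
      using \<open>y \<in> M\<close> by (auto simp: y M_def faces_codim_def)
    have "F \<subseteq> U" "F' \<subseteq> U" using F F' S face_of_imp_subset by blast+
    then have "F = F' \<and> H = H'" using eq F F' by (simp add: x y dsum_eq_iff)
    \<comment> \<open>The index is recovered from the dimension of the first face.\<close>
    then show "x = y" using F F' by (auto simp: x y)
  qed
  also have "\<dots> \<le> card (faces_codim (D + E) s (dsum S G))"
  proof (rule card_mono)
    show "finite (faces_codim (D + E) s (dsum S G))"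
      using finite_faces_dsum[OF S] by (auto simp: faces_codim_def)
    show "(\<lambda>(i, F, H). dsum F H) ` M \<subseteq> faces_codim (D + E) s (dsum S G)"
    proof clarify
      fix i F H assume "(i, F, H) \<in> M"
      then have F: "i \<le> s" "F face_of S" "F \<noteq> {}" "affine_dim F + i = D"
        "H face_of G" "H \<noteq> {}" "affine_dim H + (s - i) = E"
        by (auto simp: M_def faces_codim_def)
      have "F \<subseteq> U" using F S face_of_imp_subset by blast
      then have "affine_dim (dsum F H) + s = D + E" using F by (simp add: affine_dim_dsum)
      moreover have "dsum F H \<noteq> {}" using F by (auto simp: dsum_def)
      ultimately show "dsum F H \<in> faces_codim (D + E) s (dsum S G)"
        using face_of_dsum[OF S(1) F(2,5)] by (simp add: faces_codim_def)
    qed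
  qed
  finally show ?thesis .
qed

end

section \<open>Face numbers of polygons and of the ray\<close>

lemma faces_codim_euclidean:
  fixes P :: "'a::euclidean_space set"
  shows "faces_codim D s P = {F. F face_of P \<and> F \<noteq> {} \<and> aff_dim F + int s = int D}"
  unfolding faces_codim_def
  by (intro Collect_cong conj_cong refl) (simp add: aff_dim_eq_affine_dim flip: of_nat_add)

lemma card_extreme_points_edge_le:
  fixes F :: "'a::euclidean_space set"
  assumes "polytope F" "aff_dim F = 1"
  shows "finite {v. v extreme_point_of F} \<and> card {v. v extreme_point_of F} \<le> 2"
proof -
  have "F \<noteq> {}" using assms by auto
  moreover have "collinear F" using assms by (simp add: collinear_aff_dim)
  ultimately obtain a b where "F = closed_segment a b"
    using compact_convex_collinear_segment[of F] assms polytope_imp_compact polytope_imp_convex by metis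
  then have "{v. v extreme_point_of F} = {a, b}" by (auto simp: extreme_point_of_segment)
  then show ?thesis by (simp add: card_insert_if)
qed

text \<open>Double counting: every vertex of a polygon lies on at least two edges.\<close>

lemma card_vertices_le_card_edges:
  fixes A :: "'a::euclidean_space set"
  assumes A: "polytope A" "aff_dim A = 2"
  shows "card {v. v extreme_point_of A} \<le> card {F. F facet_of A}"
proof -
  let ?V = "{v. v extreme_point_of A}" and ?E = "{F. F facet_of A}"
  have finE: "finite ?E" using A finite_polytope_facets by blast
  have finV: "finite ?V" using A(1) by (simp add: finite_polyhedron_extreme_points polytope_imp_polyhedron)
  have two: "2 \<le> card {F \<in> ?E. v \<in> F}" if "v \<in> ?V" for v
  proof -
    have v: "{v} face_of A" using that by (simp add: face_of_singleton)
    have "{v} \<noteq> A" using A(2) by auto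
    \<comment> \<open>A proper nonempty face is the intersection of the facets containing it. No
      facet would give the whole plane and a single one an edge; neither is a point.\<close>
    then have eq: "{v} = \<Inter>{F. F facet_of A \<and> {v} \<subseteq> F}"
      by (intro face_of_polyhedron[OF polytope_imp_polyhedron[OF A(1)] v]) simp_all
    have set: "{F. F facet_of A \<and> {v} \<subseteq> F} = {F \<in> ?E. v \<in> F}" by auto
    have eq': "{v} = \<Inter>{F \<in> ?E. v \<in> F}" using eq unfolding set .
    show ?thesis
    proof (rule ccontr)
      assume "\<not> 2 \<le> card {F \<in> ?E. v \<in> F}"
      then have "card {F \<in> ?E. v \<in> F} = 0 \<or> card {F \<in> ?E. v \<in> F} = 1" by linarith
      then consider "{F \<in> ?E. v \<in> F} = {}" | F where "{F \<in> ?E. v \<in> F} = {F}"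
        using finE by (auto simp: card_1_singleton_iff)
      then show False
      proof cases
        case 1
        then have "{v} = UNIV" using eq' by (metis Inf_empty)
        then have "aff_dim A \<le> 0" by (metis aff_dim_sing aff_dim_subset subset_UNIV)
        then show False using A by simp
      next
        case 2
        then have "F facet_of A" "{v} = F" using eq' by (blast, metis cInf_singleton)
        then show False using A by (auto simp: facet_of_def)
      qed
    qed
  qed
  have "2 * card ?V \<le> (\<Sum>v\<in>?V. card {F \<in> ?E. v \<in> F})"
    using sum_bounded_below[of ?V 2 "\<lambda>v. card {F \<in> ?E. v \<in> F}"] two by (simp add: mult.commute)
  also have "\<dots> = (\<Sum>F\<in>?E. card {v \<in> ?V. v \<in> F})"
    using sum_multicount_gen[OF finV finE, of "\<lambda>v F. v \<in> F" "\<lambda>F. card {v \<in> ?V. v \<in> F}"] by auto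
  also have "\<dots> \<le> (\<Sum>F\<in>?E. 2)"
  proof (rule sum_mono)
    fix F assume "F \<in> ?E"
    then have F: "F face_of A" "aff_dim F = 1" using A by (auto simp: facet_of_def)
    have "polytope F" using F A face_of_polytope_polytope by blast
    moreover have "{v \<in> ?V. v \<in> F} = {v. v extreme_point_of F}"
      using extreme_point_of_face[OF F(1)] by blast
    ultimately show "card {v \<in> ?V. v \<in> F} \<le> 2" using card_extreme_points_edge_le[of F] F(2) by simp
  qed
  finally show ?thesis by simp
qed

text \<open>The coefficients 1, \<open>m\<close>, \<open>m\<close> stand for the polygon itself, its
  edges and its vertices. The edges are bounded below through the vertex count.\<close>

lemma polygon_faces:
  assumes "polygon m A"
  shows "finite {F. F face_of A}" "poly.coeff [:1, m, m:] i \<le> card (faces_codim 2 i A)"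
proof -
  have A: "polytope A" "aff_dim A = 2" "card {v. v extreme_point_of A} = m"
    using assms by (auto simp: polygon_def)
  show fin: "finite {F. F face_of A}" using A(1) by (rule finite_polytope_faces)
  have finc: "finite (faces_codim 2 i A)" for i using fin by (auto simp: faces_codim_def)
  consider "i = 0" | "i = 1" | "i = 2" | "i > 2" by linarith
  then show "poly.coeff [:1, m, m:] i \<le> card (faces_codim 2 i A)"
  proof cases
    case 1
    have "A \<in> faces_codim 2 0 A"
      using A by (auto simp: faces_codim_euclidean face_of_refl polytope_imp_convex)
    then have "card (faces_codim 2 0 A) > 0" using finc card_gt_0_iff by blast
    then show ?thesis using 1 by simp
  next
    case 2
    have "{F. F facet_of A} \<subseteq> faces_codim 2 1 A" using A by (auto simp: faces_codim_euclidean facet_of_def)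
    then have "card {F. F facet_of A} \<le> card (faces_codim 2 1 A)" by (rule card_mono[OF finc])
    then show ?thesis using 2 card_vertices_le_card_edges[OF A(1,2)] A(3) by simp
  next
    case 3
    have "(\<lambda>v. {v}) ` {v. v extreme_point_of A} \<subseteq> faces_codim 2 2 A"
      by (auto simp: faces_codim_euclidean face_of_singleton)
    then have "card ((\<lambda>v. {v}) ` {v. v extreme_point_of A}) \<le> card (faces_codim 2 2 A)"
      by (rule card_mono[OF finc])
    then show ?thesis using 3 A(3) by (simp add: card_image numeral_2_eq_2)
  next
    case 4
    then show ?thesis by (simp add: coeff_eq_0)
  qed
qed

lemma ray_faces:
  shows "finite {F. F face_of {0::real..}}" "poly.coeff [:1, 1:] i \<le> card (faces_codim 1 i {0::real..})"
proof -
  have "polyhedron {0::real..}"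
  proof -
    have "{0::real..} = {x. 1 \<bullet> x \<ge> 0}" by auto
    then show ?thesis using polyhedron_halfspace_ge[of 0 "1::real"] by (simp only:)
  qed
  then show fin: "finite {F. F face_of {0::real..}}" by (rule finite_polyhedron_faces)
  have finc: "finite (faces_codim 1 i {0::real..})" for i using fin by (auto simp: faces_codim_def)
  consider "i = 0" | "i = 1" | "i > 1" by linarith
  then show "poly.coeff [:1, 1:] i \<le> card (faces_codim 1 i {0::real..})"
  proof cases
    case 1
    have "aff_dim {0::real..} = 1"
    proof -
      have "interior {0::real..} \<noteq> {}" by (simp add: interior_real_atLeast)
      then show ?thesis by (subst aff_dim_nonempty_interior) auto
    qed
    then have "{0::real..} \<in> faces_codim 1 0 {0::real..}"
      by (auto simp: faces_codim_euclidean face_of_refl)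
    then have "card (faces_codim 1 0 {0::real..}) > 0" using finc card_gt_0_iff by blast
    then show ?thesis using 1 by simp
  next
    case 2
    have "{0} face_of {0::real..}"
      by (auto simp: face_of_singleton extreme_point_of_def open_segment_eq_real_ivl)
    then have "{0::real} \<in> faces_codim 1 1 {0::real..}" by (simp add: faces_codim_euclidean)
    then have "card (faces_codim 1 1 {0::real..}) > 0" using finc card_gt_0_iff by blast
    then show ?thesis using 2 by simp
  next
    case 3
    then show ?thesis by (simp add: coeff_eq_0)
  qed
qed

section \<open>Comparison of the face numbers\<close>


context moment_polar
begin

lemma inj_on_act: "inj_on act {F. F face_of dcp \<and> F \<noteq> {} \<and> P F}"
proof (rule inj_onI)
  fix F G assume "F \<in> {F. F face_of dcp \<and> F \<noteq> {} \<and> P F}" "G \<in> {F. F face_of dcp \<and> F \<noteq> {} \<and> P F}"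
    and "act F = act G"
  then show "F = G" using face_eq_act[of F] face_eq_act[of G] by simp
qed

lemma fnum_dcp_eq_card_act: "fnum k dcp = card (act ` {F. F face_of dcp \<and> F \<noteq> {} \<and> affine_dim F = k})"
  unfolding fnum_def by (rule card_image[symmetric, OF inj_on_act])

text \<open>The set \<open>V\<close> is the active set of a vertex of \<open>F\<close>; fewer
  constraints are tight on all of \<open>F\<close> than at one of its points, or equally
  many.\<close>

lemma ex_gale_set:
  assumes F: "F face_of dcp" "F \<noteq> {}"
  shows "\<exists>V\<subseteq>{..<n}. act F \<subseteq> V \<and> card V = d \<and>
    (\<forall>i\<in>{..<n} - V. \<forall>j\<in>{..<n} - V. even (card {l \<in> V. i < l}) = even (card {l \<in> V. j < l}))"
proof -
  obtain y where y: "y \<in> F" "card (act {y}) = d" using ex_vertex[OF F] by blast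
  moreover have "y \<in> dcp" using y F subset_dcp by blast
  moreover have "act F \<subseteq> act {y}" using y by (auto simp: active_def)
  ultimately show ?thesis using vertex_parity act_subset by (intro exI[of _ "act {y}"]) blast
qed

lemma card_pairs:
  assumes "finite J" "J \<inter> \<sigma> ` J = {}" "inj_on \<sigma> J"
  shows "card (J \<union> \<sigma> ` J) = 2 * card J"
  using assms by (simp add: card_Un_disjoint card_image)

lemma fnum_dcp_le_even:
  assumes d: "d = 2 * h" and s: "s + k = d"
  shows "fnum k dcp \<le> (\<Sum>q\<le>min h s. (n choose q) * (q choose (s - q)))"
proof -
  let ?\<I> = "act ` {F. F face_of dcp \<and> F \<noteq> {} \<and> affine_dim F = k}"
  let ?\<sigma> = "\<lambda>i. Suc i mod n"
  have "finite ?\<I> \<and> card ?\<I> \<le> (\<Sum>q\<le>min h s. (n choose q) * (q choose (s - q)))"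
  proof (rule card_subsets_of_pairs_le)
    show "finite {..<n}" "card {..<n} = n" by auto
    fix I assume "I \<in> ?\<I>"
    then obtain F where F: "F face_of dcp" "F \<noteq> {}" "affine_dim F = k" "I = act F" by auto
    have "card I = s" using affine_dim_dcp_face[OF F(1,2)] F s by simp
    moreover obtain V where V: "V \<subseteq> {..<n}" "I \<subseteq> V" "card V = d"
      "\<forall>i\<in>{..<n} - V. \<forall>j\<in>{..<n} - V. even (card {l \<in> V. i < l}) = even (card {l \<in> V. j < l})"
      using ex_gale_set[OF F(1,2)] F(4) by blast
    have "even (card V)" using V(3) d by simp
    then obtain J where J: "J \<inter> ?\<sigma> ` J = {}" "V = J \<union> ?\<sigma> ` J"
      using gale_even[OF V(1) _ V(4)[rule_format]] by blast
    have inj: "inj_on ?\<sigma> J"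
    proof (rule inj_onI)
      fix i j assume "i \<in> J" "j \<in> J" "Suc i mod n = Suc j mod n"
      moreover have "i < n" "j < n" using calculation J V by auto
      ultimately show "i = j" by (auto simp: mod_Suc split: if_splits)
    qed
    have "finite J" using V(1) J(2) by (auto intro: finite_subset[of _ "{..<n}"])
    then have "card J = h" using card_pairs[OF _ J(1) inj] J V d by simp
    then show "card I = s \<and> (\<exists>J. card J \<le> h \<and> J \<inter> ?\<sigma> ` J = {} \<and> inj_on ?\<sigma> J \<and> J \<union> ?\<sigma> ` J \<subseteq> {..<n} \<and> I \<subseteq> J \<union> ?\<sigma> ` J)"
      using \<open>card I = s\<close> J V inj by (intro conjI exI[of _ J]) auto
  qed
  then show ?thesis by (simp add: fnum_dcp_eq_card_act)
qed

lemma fnum_dcp_le_odd: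
  assumes d: "d = 2 * h + 1" and n: "0 < n" and s: "s + k = d"
  defines "B \<equiv> \<lambda>s. \<Sum>q\<le>min h s. ((n - 1) choose q) * (q choose (s - q))"
  shows "fnum k dcp \<le> 2 * (B s + (if s = 0 then 0 else B (s - 1)))"
proof -
  let ?\<I> = "act ` {F. F face_of dcp \<and> F \<noteq> {} \<and> affine_dim F = k}"
  \<comment> \<open>Sets that avoid the end node \<open>e\<close> use only the other
    \<open>n - 1\<close> nodes, hence \<open>n - 1\<close> in \<open>B\<close>.\<close>
  define \<A> where "\<A> e s = {I. card I = s \<and> (\<exists>J. card J \<le> h \<and> J \<inter> Suc ` J = {} \<and>
      inj_on Suc J \<and> J \<union> Suc ` J \<subseteq> {..<n} - {e} \<and> I \<subseteq> J \<union> Suc ` J)}" for e s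
  have \<A>: "finite (\<A> e s) \<and> card (\<A> e s) \<le> B s" if "e < n" for e s
    unfolding B_def using that
    by (intro card_subsets_of_pairs_le[where X = "{..<n} - {e}" and \<sigma> = Suc]) (auto simp: \<A>_def)
  \<comment> \<open>Sets containing \<open>e\<close> come from sets of size \<open>s - 1\<close>.
    The guard is needed because \<open>s - 1\<close> is 0 for \<open>s = 0\<close>, where no set
    contains \<open>e\<close>.\<close>
  define \<B> where "\<B> e = \<A> e s \<union> (if s = 0 then {} else insert e ` \<A> e (s - 1))" for e
  have \<B>: "finite (\<B> e)" "card (\<B> e) \<le> B s + (if s = 0 then 0 else B (s - 1))" if "e < n" for e
  proof -
    show "finite (\<B> e)" using \<A>[OF that] by (auto simp: \<B>_def)
    have "card (insert e ` \<A> e (s - 1)) \<le> B (s - 1)"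
      using \<A>[OF that, of "s - 1"] card_image_le[of "\<A> e (s - 1)" "insert e"] by linarith
    then show "card (\<B> e) \<le> B s + (if s = 0 then 0 else B (s - 1))"
      using \<A>[OF that, of s] card_Un_le[of "\<A> e s" "insert e ` \<A> e (s - 1)"] by (auto simp: \<B>_def)
  qed
  have "?\<I> \<subseteq> \<B> 0 \<union> \<B> (n - 1)"
  proof
    fix I assume "I \<in> ?\<I>"
    then obtain F where F: "F face_of dcp" "F \<noteq> {}" "affine_dim F = k" "I = act F" by auto
    have cI: "card I = s" using affine_dim_dcp_face[OF F(1,2)] F s by simp
    have fI: "finite I" using F by simp
    obtain V where V: "V \<subseteq> {..<n}" "I \<subseteq> V" "card V = d"
      "\<forall>i\<in>{..<n} - V. \<forall>j\<in>{..<n} - V. even (card {l \<in> V. i < l}) = even (card {l \<in> V. j < l})"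
      using ex_gale_set[OF F(1,2)] F(4) by blast
    have "odd (card V)" using V(3) d by simp
    then obtain e J where e: "e \<in> {0, n - 1}" and J: "J \<inter> Suc ` J = {}" "e \<notin> J \<union> Suc ` J" "V = insert e (J \<union> Suc ` J)"
      using gale_odd[OF V(1) _ V(4)[rule_format]] by blast
    have "finite V" using V(1) by (rule finite_subset) simp
    then have "finite J" using J(3) by auto
    have "card V = Suc (card (J \<union> Suc ` J))" using J \<open>finite J\<close> by simp
    then have "card J = h" using card_pairs[of J Suc] \<open>finite J\<close> J(1) V(3) d by simp
    then have mem: "I' \<in> \<A> e (card I')" if "I' \<subseteq> J \<union> Suc ` J" for I'
      using that J V(1) unfolding \<A>_def by (intro CollectI conjI refl exI[of _ J]) auto
    have "I \<in> \<B> e"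
    proof (cases "e \<in> I")
      case True
      have "I - {e} \<in> \<A> e (card (I - {e}))" using V J by (intro mem) auto
      moreover have "card (I - {e}) = s - 1" "s \<noteq> 0" using True fI cI by (auto simp: card_gt_0_iff)
      moreover have "I = insert e (I - {e})" using True by auto
      ultimately have "I \<in> insert e ` \<A> e (s - 1)" by (metis imageI)
      then show ?thesis using \<open>s \<noteq> 0\<close> by (simp add: \<B>_def)
    next
      case False
      then have "I \<in> \<A> e (card I)" using V J by (intro mem) auto
      then show ?thesis by (simp add: \<B>_def cI)
    qed
    then show "I \<in> \<B> 0 \<union> \<B> (n - 1)" using e by auto
  qed
  then have "card ?\<I> \<le> card (\<B> 0 \<union> \<B> (n - 1))" using \<B> n by (intro card_mono) auto
  also have "\<dots> \<le> card (\<B> 0) + card (\<B> (n - 1))" by (rule card_Un_le)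
  finally show ?thesis using \<B>(2)[of 0] \<B>(2)[of "n - 1"] n by (simp add: fnum_dcp_eq_card_act)
qed

lemma fnum_dcp_eq_0:
  assumes "d < k"
  shows "fnum k dcp = 0"
proof -
  have "affine_dim F \<noteq> k" if "F face_of dcp" "F \<noteq> {}" for F
    using affine_dim_dcp_face[OF that] assms by linarith
  then have "{F. F face_of dcp \<and> F \<noteq> {} \<and> affine_dim F = k} = {}" by blast
  then show ?thesis unfolding fnum_def by (simp only: card.empty)
qed

end

section \<open>From an interior point to the constraints at the nodes\<close>

lemma convex_dot_le: "convex {x. dot d (x - c) y \<le> b}"
proof -
  have "{x. dot d (x - c) y \<le> b} = {x. dot d x y \<le> b + dot d c y}"
    by (auto simp: linear_diff[OF linear_dot_left])
  also have "\<dots> = (\<lambda>x. dot d x y) -` {..b + dot d c y}" by auto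
  also have "convex \<dots>" using linear_dot_left by (intro convex_linear_vimage) auto
  finally show ?thesis .
qed

lemma dot_self_le_0_imp:
  assumes "v \<in> Rn d" "dot d v v \<le> 0"
  shows "v = 0"
proof (rule poly_mapping_eqI)
  fix i
  have "(\<Sum>i<d. Poly_Mapping.lookup v i * Poly_Mapping.lookup v i) = 0"
    using assms(2) by (intro antisym sum_nonneg) (auto simp: dot_def)
  then show "Poly_Mapping.lookup v i = Poly_Mapping.lookup 0 i"
    using assms(1) by (cases "i < d") (auto simp: sum_nonneg_eq_0_iff in_Rn_iff)
qed

text \<open>A linear inequality at the nodes extends to their convex hull, so the polar is cut out
  by the nodes. If no node constraint increased along \<open>v\<close>, the point
  \<open>c + \<epsilon> v\<close> of the polytope would give
  \<open>dot d v v \<le> 0\<close>.\<close>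

lemma dual_cyclic_imp_moment_polar:
  assumes "dual_cyclic n d Q"
  shows "\<exists>t c. moment_polar n d t c \<and> Q = moment_polar.dcp n d t c"
proof -
  obtain t c where tc: "strict_mono_on {..<n} t"
    "c \<in> (top_of_set (Rn d)) interior_of (cyclic_polytope n d t)"
    "Q = polar d ((\<lambda>x. x - c) ` cyclic_polytope n d t)"
    using assms by (auto simp: dual_cyclic_def)
  let ?P = "cyclic_polytope n d t"
  have P_le: "dot d (x - c) y \<le> b"
    if "\<And>j. j < n \<Longrightarrow> dot d (moment_curve d (t j) - c) y \<le> b" "x \<in> ?P" for x y b
  proof -
    have "?P \<subseteq> {x. dot d (x - c) y \<le> b}"
      unfolding cyclic_polytope_def by (rule hull_minimal) (use that convex_dot_le in auto)
    then show ?thesis using that by blast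
  qed
  obtain T where T: "openin (top_of_set (Rn d)) T" "c \<in> T" "T \<subseteq> ?P"
    using tc(2) by (auto simp: interior_of_def)
  then obtain N where N: "open N" "T = Rn d \<inter> N" by (auto simp: openin_open)
  then obtain r where r: "r > 0" "ball c r \<subseteq> N" using T open_contains_ball by blast
  interpret moment_polar n d t c
  proof
    show "strict_mono_on {..<n} t" by fact
    fix v assume v: "v \<in> Rn d" "v \<noteq> 0"
    show "\<exists>j<n. 0 < dot d (moment_curve d (t j) - c) v"
    proof (rule ccontr)
      assume "\<not> ?thesis"
      then have le: "dot d (moment_curve d (t j) - c) v \<le> 0" if "j < n" for j
        using that by (metis not_less)
      \<comment> \<open>The point moves by half the radius, so it stays in the ball around
        \<open>c\<close>.\<close>
      define \<epsilon> where "\<epsilon> = r / (2 * norm v)"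
      have "\<epsilon> > 0" using r v by (simp add: \<epsilon>_def)
      have "dist c (c + \<epsilon> *\<^sub>R v) < r" using r v by (simp add: dist_norm \<epsilon>_def)
      then have "c + \<epsilon> *\<^sub>R v \<in> N" using r by auto
      moreover have "c + \<epsilon> *\<^sub>R v \<in> Rn d"
        using v T N subspace_Rn by (intro subspace_add subspace_scale) auto
      ultimately have "c + \<epsilon> *\<^sub>R v \<in> ?P" using N T by auto
      then have "dot d ((c + \<epsilon> *\<^sub>R v) - c) v \<le> 0" using P_le[OF le] by blast
      then have "\<epsilon> * dot d v v \<le> 0" by (simp add: linear_scale[OF linear_dot_left])
      then have "dot d v v \<le> 0" using \<open>\<epsilon> > 0\<close> by (simp add: mult_le_0_iff)
      then show False using dot_self_le_0_imp v by blast
    qed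
  qed
  have "Q = dcp"
  proof
    have "moment_curve d (t j) \<in> ?P" if "j < n" for j
      using that by (auto simp: cyclic_polytope_def intro!: hull_inc)
    then show "Q \<subseteq> dcp" by (auto simp: tc(3) polar_def dcp_def con_def)
    show "dcp \<subseteq> Q" using P_le by (auto simp: tc(3) polar_def dcp_def con_def)
  qed
  then show ?thesis using moment_polar_axioms by blast
qed

section \<open>Lower bounds for the products of polygons\<close>

text \<open>The even case of \<open>P_star\<close>, parametrized by the number of polygons so that
  an induction can split off the last one as a direct summand.\<close>

definition prod_polygons :: "nat \<Rightarrow> (nat \<Rightarrow> (real \<times> real) set) \<Rightarrow> (nat \<Rightarrow>\<^sub>0 real) set" where
  "prod_polygons h A = {x \<in> Rn (2 * h). \<forall>i<h.
     (Poly_Mapping.lookup x (2 * i), Poly_Mapping.lookup x (2 * i + 1)) \<in> A i}"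

lemma Rn_subset_span: "Rn d \<subseteq> span ((\<lambda>i. Poly_Mapping.single i 1) ` {..<d})"
proof
  fix x assume x: "x \<in> Rn d"
  have "x = (\<Sum>i<d. Poly_Mapping.lookup x i *\<^sub>R Poly_Mapping.single i 1)" (is "_ = ?s")
  proof (rule poly_mapping_eqI)
    fix l
    have "Poly_Mapping.lookup ?s l = (\<Sum>i<d. if i = l then Poly_Mapping.lookup x l else 0)"
      unfolding lookup_sum by (intro sum.cong) (auto simp: lookup_single when_def)
    then show "Poly_Mapping.lookup x l = Poly_Mapping.lookup ?s l" using x by (auto simp: in_Rn_iff)
  qed
  moreover have "?s \<in> span ((\<lambda>i. Poly_Mapping.single i 1) ` {..<d})"
    by (intro span_sum span_scale span_base) auto
  ultimately show "x \<in> span ((\<lambda>i. Poly_Mapping.single i 1) ` {..<d})" by simp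
qed

definition embed_plane :: "nat \<Rightarrow> real \<times> real \<Rightarrow> (nat \<Rightarrow>\<^sub>0 real)" where
  "embed_plane j z = Poly_Mapping.single j (fst z) + Poly_Mapping.single (j + 1) (snd z)"

lemma lookup_embed_plane:
  "Poly_Mapping.lookup (embed_plane j z) i = (if i = j then fst z else if i = j + 1 then snd z else 0)"
  by (auto simp: embed_plane_def lookup_add lookup_single when_def)

lemma direct_sum_embed_plane:
  "direct_sum (embed_plane j) (Rn j) ((\<lambda>i. Poly_Mapping.single i 1) ` {..<j})"
proof
  show "embed_plane j (x + y) = embed_plane j x + embed_plane j y" for x y
    by (rule poly_mapping_eqI) (simp add: lookup_embed_plane lookup_add)
  show "embed_plane j (r *\<^sub>R x) = r *\<^sub>R embed_plane j x" for r x
    by (rule poly_mapping_eqI) (simp add: lookup_embed_plane)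
  show "subspace (Rn j)" by (rule subspace_Rn)
  show "Rn j \<subseteq> span ((\<lambda>i. Poly_Mapping.single i 1) ` {..<j})" by (rule Rn_subset_span)
  show "z = 0" if "embed_plane j z \<in> Rn j" for z
  proof (rule prod_eqI)
    have *: "Poly_Mapping.lookup (embed_plane j z) i = 0" if "i \<ge> j" for i
      using \<open>embed_plane j z \<in> Rn j\<close> that by (simp add: in_Rn_iff)
    show "fst z = fst 0" "snd z = snd 0" using *[of j] *[of "j + 1"] by (simp_all add: lookup_embed_plane)
  qed
qed auto

lemma direct_sum_single:
  "direct_sum (Poly_Mapping.single j :: real \<Rightarrow> _) (Rn j) ((\<lambda>i. Poly_Mapping.single i 1) ` {..<j})"
proof
  show "Poly_Mapping.single j (x + y) = Poly_Mapping.single j x + Poly_Mapping.single j y" for x y :: real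
    by (rule single_add)
  show "Poly_Mapping.single j (r *\<^sub>R x) = r *\<^sub>R Poly_Mapping.single j x" for r x :: real
    by (rule poly_mapping_eqI) (simp add: lookup_single when_def)
  show "subspace (Rn j)" by (rule subspace_Rn)
  show "Rn j \<subseteq> span ((\<lambda>i. Poly_Mapping.single i 1) ` {..<j})" by (rule Rn_subset_span)
  show "z = 0" if "Poly_Mapping.single j z \<in> Rn j" for z :: real
    using that by (auto simp: in_Rn_iff dest: spec[of _ j])
qed auto

lemma prod_polygons_faces:
  assumes "\<And>i. i < h \<Longrightarrow> polygon m (A i)"
  shows "finite {F. F face_of prod_polygons h A} \<and>
    (\<forall>s. poly.coeff ([:1, m, m:] ^ h) s \<le> card (faces_codim (2 * h) s (prod_polygons h A)))"
  using assms
proof (induction h)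
  \<comment> \<open>The empty product is the point 0, which contributes one face of codimension 0
    and matches the polynomial 1.\<close>
  case 0
  have P: "prod_polygons 0 A = {0}"
    by (auto simp: prod_polygons_def in_Rn_iff intro: poly_mapping_eqI)
  have "{F. F face_of {0::nat \<Rightarrow>\<^sub>0 real}} \<subseteq> Pow {0}" by (auto dest: face_of_imp_subset)
  then have fin: "finite {F. F face_of {0::nat \<Rightarrow>\<^sub>0 real}}" by (rule finite_subset) simp
  have "affine_dim {0::nat \<Rightarrow>\<^sub>0 real} = 0"
  proof -
    have "{x - y | x y. x \<in> {0::nat \<Rightarrow>\<^sub>0 real} \<and> y \<in> {0}} = {0}" by auto
    moreover have "dim {0::nat \<Rightarrow>\<^sub>0 real} = 0"
      by (rule dim_unique[of "{}"]) (simp_all add: independent_empty)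
    ultimately show ?thesis unfolding affine_dim_def by simp
  qed
  then have "{0} \<in> faces_codim 0 0 {0::nat \<Rightarrow>\<^sub>0 real}" by (auto simp: faces_codim_def face_of_refl)
  moreover have "finite (faces_codim 0 0 {0::nat \<Rightarrow>\<^sub>0 real})" using fin by (auto simp: faces_codim_def)
  ultimately have "card (faces_codim 0 0 {0::nat \<Rightarrow>\<^sub>0 real}) > 0" using card_gt_0_iff by blast
  then show ?case using fin by (auto simp: P one_pCons coeff_pCons Suc_le_eq split: nat.splits)
next
  case (Suc h)
  interpret direct_sum "embed_plane (2 * h)" "Rn (2 * h)" "(\<lambda>i. Poly_Mapping.single i 1) ` {..<2 * h}"
    by (rule direct_sum_embed_plane)
  have IH: "finite {F. F face_of prod_polygons h A}"
    "\<And>s. poly.coeff ([:1, m, m:] ^ h) s \<le> card (faces_codim (2 * h) s (prod_polygons h A))"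
    using Suc by auto
  have A: "polygon m (A h)" using Suc.prems by simp
  have sub: "prod_polygons h A \<subseteq> Rn (2 * h)" by (auto simp: prod_polygons_def)
  have eq: "prod_polygons (Suc h) A = dsum (prod_polygons h A) (A h)"
  proof
    show "prod_polygons (Suc h) A \<subseteq> dsum (prod_polygons h A) (A h)"
    proof
      fix x assume x: "x \<in> prod_polygons (Suc h) A"
      define z where "z = (Poly_Mapping.lookup x (2 * h), Poly_Mapping.lookup x (2 * h + 1))"
      \<comment> \<open>Splitting off the last two coordinates leaves a point of the smaller
        product.\<close>
      define u where "u = x - embed_plane (2 * h) z"
      have lu: "Poly_Mapping.lookup u i = (if i < 2 * h then Poly_Mapping.lookup x i else 0)" for i
        using x by (auto simp: u_def z_def lookup_minus lookup_embed_plane prod_polygons_def in_Rn_iff)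
      have "u \<in> prod_polygons h A" using x by (auto simp: prod_polygons_def in_Rn_iff lu)
      moreover have "z \<in> A h" using x by (auto simp: z_def prod_polygons_def)
      ultimately have "u + embed_plane (2 * h) z \<in> dsum (prod_polygons h A) (A h)" by (rule dsumI)
      then show "x \<in> dsum (prod_polygons h A) (A h)" by (simp add: u_def)
    qed
    show "dsum (prod_polygons h A) (A h) \<subseteq> prod_polygons (Suc h) A"
    proof
      fix x assume "x \<in> dsum (prod_polygons h A) (A h)"
      then obtain u z where x: "x = u + embed_plane (2 * h) z" "u \<in> prod_polygons h A" "z \<in> A h"
        by (auto simp: dsum_def)
      then show "x \<in> prod_polygons (Suc h) A"
        by (auto simp: prod_polygons_def in_Rn_iff lookup_add lookup_embed_plane less_Suc_eq)
    qed
  qed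
  have "finite {F. F face_of prod_polygons (Suc h) A}"
    unfolding eq using sub IH(1) polygon_faces(1)[OF A] by (rule finite_faces_dsum)
  moreover have "poly.coeff ([:1, m, m:] ^ h * [:1, m, m:]) s \<le>
      card (faces_codim (2 * h + 2) s (prod_polygons (Suc h) A))" for s
    unfolding eq using sub IH(1) polygon_faces(1)[OF A] IH(2) polygon_faces(2)[OF A]
    by (rule coeff_mult_le_card_faces_codim)
  ultimately show ?case by (simp only: power_Suc2 mult_Suc_right add.commute[of 2] HOL.simp_thms)
qed

lemma P_star_even_fnum_ge:
  assumes "P_star n d P" "even d" "s + k = d"
  shows "poly.coeff ([:1, n div (d div 2), n div (d div 2):] ^ (d div 2)) s \<le> fnum k P"
  using assms(1)
proof cases
  case (even A)
  then have "P = prod_polygons (d div 2) A" using assms(2) by (simp add: prod_polygons_def)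
  then have "poly.coeff ([:1, n div (d div 2), n div (d div 2):] ^ (d div 2)) s
      \<le> card (faces_codim (2 * (d div 2)) s P)"
    using prod_polygons_faces[of "d div 2" "n div (d div 2)" A] even by auto
  then show ?thesis using assms fnum_eq_card_faces_codim[of k s d P] by (simp add: add.commute)
qed (use assms in simp)

text \<open>The last coordinate contributes a ray, whose faces are itself and its apex; this gives
  the factor \<open>1 + x\<close>.\<close>

lemma P_star_odd_fnum_ge:
  assumes "P_star n d P" "odd d" "s + k = d"
  defines "m \<equiv> (n - 1) div (d div 2)"
  shows "poly.coeff ([:1, m, m:] ^ (d div 2) * [:1, 1:]) s \<le> fnum k P"
  using assms(1)
proof cases
  case (odd Q)
  have d: "even (d - 1)" "(d - 1) div 2 = d div 2" "2 * (d div 2) = d - 1" "Suc (d - 1) = d" using assms(2) by presburger+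
  from odd(3) obtain A where A: "\<And>i. i < d div 2 \<Longrightarrow> polygon m (A i)" and Q: "Q = prod_polygons (d div 2) A"
    using d by cases (auto simp: prod_polygons_def m_def)
  have QR: "Q \<subseteq> Rn (d - 1)" using Q d by (auto simp: prod_polygons_def)
  interpret direct_sum "Poly_Mapping.single (d - 1) :: real \<Rightarrow> _" "Rn (d - 1)" "(\<lambda>i. Poly_Mapping.single i 1) ` {..<d - 1}"
    by (rule direct_sum_single)
  have "P = dsum Q {0..}"
  proof
    show "P \<subseteq> dsum Q {0..}"
    proof
      fix x assume x: "x \<in> P"
      let ?u = "Poly_Mapping.update (d - 1) 0 x" and ?z = "Poly_Mapping.lookup x (d - 1)"
      have "x = ?u + Poly_Mapping.single (d - 1) ?z"
        by (rule poly_mapping_eqI) (auto simp: lookup_add lookup_update lookup_single when_def)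
      moreover have "?u + Poly_Mapping.single (d - 1) ?z \<in> dsum Q {0..}"
        by (rule dsumI) (use x odd in auto)
      ultimately show "x \<in> dsum Q {0..}" by simp
    qed
    show "dsum Q {0..} \<subseteq> P"
    proof
      fix x assume "x \<in> dsum Q {0..}"
      then obtain u z where x: "x = u + Poly_Mapping.single (d - 1) z" "u \<in> Q" "z \<in> {0..}"
        unfolding dsum_def by blast
      have lu: "Poly_Mapping.lookup u i = 0" if "i \<ge> d - 1" for i
        using x QR that by (auto simp: in_Rn_iff)
      have "Poly_Mapping.update (d - 1) 0 x = u"
        by (rule poly_mapping_eqI) (auto simp: x lookup_add lookup_update lookup_single when_def lu)
      then show "x \<in> P"
        using x lu odd_pos[OF assms(2)] by (auto simp: odd in_Rn_iff lookup_add lookup_single when_def)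
    qed
  qed
  moreover have "poly.coeff ([:1, m, m:] ^ (d div 2) * [:1, 1:]) s
      \<le> card (faces_codim (2 * (d div 2) + 1) s (dsum Q {0..}))"
    using prod_polygons_faces[of "d div 2" m A] A QR ray_faces
    by (intro coeff_mult_le_card_faces_codim) (auto simp: Q)
  ultimately show ?thesis
    using assms d fnum_eq_card_faces_codim[of k s d P] by (simp add: add.commute)
qed (use assms in simp)

section \<open>The comparison and the two asymptotic bounds\<close>

text \<open>Divisibility lets the number of nodes (one less for odd \<open>d\<close>) be written as
  \<open>h m\<close>, so both sides are sums of the same shape. The minimum in the exponent serves
  both ranges of \<open>k\<close>; the factor 2 accounts for the two end nodes in odd
  dimension.\<close>

lemma fnum_dual_cyclic_le_P_star:
  assumes d: "2 \<le> d" "d < n" and dvd: "if even d then d div 2 dvd n else d div 2 dvd n - 1"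
    and P: "P_star n d P" and Q: "dual_cyclic n d Q" and k: "k \<le> d"
  shows "real (fnum k Q) \<le> 2 * exp (real (min (d div 2) (d - k))) * real (fnum k P)"
proof -
  obtain t c where tc: "moment_polar n d t c" "Q = moment_polar.dcp n d t c"
    using dual_cyclic_imp_moment_polar[OF Q] by blast
  interpret moment_polar n d t c by (rule tc)
  define h s where "h = d div 2" and "s = d - k"
  define B where "B N s = (\<Sum>q\<le>min h s. (N choose q) * (q choose (s - q)))" for N s
  have s: "s + k = d" using k by (simp add: s_def)
  show ?thesis
  proof (cases "even d")
    case True
    define m where "m = n div h"
    have n: "n = h * m" using dvd True by (simp add: m_def h_def)
    have "fnum k Q \<le> B n s"
      using fnum_dcp_le_even[OF _ s, of h] True by (simp add: tc(2) B_def h_def)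
    then have "real (fnum k Q) \<le> real (B n s)" by (rule of_nat_mono)
    also have "\<dots> \<le> exp (real (min h s)) * real (poly.coeff ([:1, m, m:] ^ h) s)"
      using sum_binomial_le_coeff[where h = h and m = m and s = s] by (simp only: B_def n)
    also have "\<dots> \<le> exp (real (min h s)) * real (fnum k P)"
      using P_star_even_fnum_ge[OF P True s] by (intro mult_left_mono) (simp_all add: m_def h_def)
    also have "\<dots> \<le> 2 * exp (real (min h s)) * real (fnum k P)" by simp
    finally show ?thesis by (simp add: h_def s_def)
  next
    case False
    define m where "m = (n - 1) div h"
    have n: "n - 1 = h * m" using dvd False by (simp add: m_def h_def)
    let ?c = "\<lambda>s. poly.coeff ([:1, m, m:] ^ h) s"
    \<comment> \<open>The terms for \<open>s\<close> and \<open>s - 1\<close> share the larger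
      exponential factor.\<close>
    have le: "real (B (n - 1) r) \<le> exp (real (min h s)) * real (?c r)" if "r \<le> s" for r
    proof -
      have "real (B (n - 1) r) \<le> exp (real (min h r)) * real (?c r)"
        using sum_binomial_le_coeff[where h = h and m = m and s = r] by (simp only: B_def n)
      also have "\<dots> \<le> exp (real (min h s)) * real (?c r)"
        using that by (intro mult_right_mono) auto
      finally show ?thesis .
    qed
    \<comment> \<open>The ray shifts the coefficients by one, matching the two terms of the upper
      bound.\<close>
    have c: "poly.coeff ([:1, m, m:] ^ h * [:1, 1:]) s = ?c s + (if s = 0 then 0 else ?c (s - 1))"
      by (cases s) (simp_all add: mult.commute[of _ "[:1, 1:]"])
    have "fnum k Q \<le> 2 * (B (n - 1) s + (if s = 0 then 0 else B (n - 1) (s - 1)))"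
      unfolding tc(2) B_def by (rule fnum_dcp_le_odd) (use False d s in \<open>simp_all add: h_def\<close>)
    then have "real (fnum k Q) \<le> real (2 * (B (n - 1) s + (if s = 0 then 0 else B (n - 1) (s - 1))))"
      by (rule of_nat_mono)
    also have "\<dots> = 2 * (real (B (n - 1) s) + (if s = 0 then 0 else real (B (n - 1) (s - 1))))"
      by simp
    also have "\<dots> \<le> 2 * (exp (real (min h s)) * real (?c s + (if s = 0 then 0 else ?c (s - 1))))"
      using le[of s] le[of "s - 1"] by (auto simp: distrib_left)
    also have "\<dots> \<le> 2 * (exp (real (min h s)) * real (fnum k P))"
      unfolding c[symmetric] using P_star_odd_fnum_ge[OF P False s]
      by (intro mult_left_mono) (simp_all add: m_def h_def)
    finally show ?thesis by (simp add: h_def s_def)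
  qed
qed

lemma fnum_dual_cyclic_eq_0:
  assumes "dual_cyclic n d Q" "d < k"
  shows "fnum k Q = 0"
  using dual_cyclic_imp_moment_polar[OF assms(1)] moment_polar.fnum_dcp_eq_0[OF _ assms(2)] by metis

theorem theorem3p5:
  shows "(\<exists>(C::real) (p::real poly). C > 0 \<and>
           (\<forall>n d k P Q. 2 \<le> d \<and> d < n \<and>
              (if even d then d div 2 dvd n else d div 2 dvd n - 1) \<and>
              P_star n d P \<and> dual_cyclic n d Q \<and> int k < \<lceil>real d / 2\<rceil> \<longrightarrow>
              real (fnum k Q) \<le> C * (poly p (real d) * exp (real (d div 2))) * real (fnum k P)))
       \<and> (\<exists>(C::real) (p::real poly). C > 0 \<and>
           (\<forall>n d k P Q. 2 \<le> d \<and> d < n \<and>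
              (if even d then d div 2 dvd n else d div 2 dvd n - 1) \<and>
              P_star n d P \<and> dual_cyclic n d Q \<and> int k \<ge> \<lceil>real d / 2\<rceil> \<longrightarrow>
              real (fnum k Q) \<le> C * (poly p (real d) * exp (real d - real k)) * real (fnum k P)))"
proof -
  \<comment> \<open>Both exponents of the theorem bound the minimum of \<open>d div 2\<close> and
    \<open>d - k\<close> when \<open>k \<le> d\<close>, so the constant 2 and the polynomial 1 serve
    both parts. For \<open>k > d\<close> the left side is 0.\<close>
  have main: "real (fnum k Q) \<le> 2 * (poly 1 (real d) * exp E) * real (fnum k P)"
    if "2 \<le> d" "d < n" "if even d then d div 2 dvd n else d div 2 dvd n - 1"
      "P_star n d P" "dual_cyclic n d Q" "k \<le> d \<Longrightarrow> real (min (d div 2) (d - k)) \<le> E"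
    for n d k P Q E
  proof (cases "k \<le> d")
    case True
    have "exp (real (min (d div 2) (d - k))) \<le> exp E" using that(6) True by simp
    then have "2 * exp (real (min (d div 2) (d - k))) * real (fnum k P) \<le> 2 * exp E * real (fnum k P)"
      by (intro mult_right_mono) auto
    then show ?thesis using fnum_dual_cyclic_le_P_star[OF that(1-5) True] by simp
  next
    case False
    then show ?thesis using fnum_dual_cyclic_eq_0[OF that(5)] by simp
  qed
  show ?thesis
  proof (intro conjI exI[of _ "2::real"] exI[of _ "1::real poly"] allI impI)
    fix n d k P Q
    assume "2 \<le> d \<and> d < n \<and> (if even d then d div 2 dvd n else d div 2 dvd n - 1) \<and>
      P_star n d P \<and> dual_cyclic n d Q \<and> int k < \<lceil>real d / 2\<rceil>"
    then show "real (fnum k Q) \<le> 2 * (poly 1 (real d) * exp (real (d div 2))) * real (fnum k P)"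
      by (intro main) auto
  next
    fix n d k P Q
    assume "2 \<le> d \<and> d < n \<and> (if even d then d div 2 dvd n else d div 2 dvd n - 1) \<and>
      P_star n d P \<and> dual_cyclic n d Q \<and> int k \<ge> \<lceil>real d / 2\<rceil>"
    then show "real (fnum k Q) \<le> 2 * (poly 1 (real d) * exp (real d - real k)) * real (fnum k P)"
      by (intro main) (auto simp: of_nat_diff)
  qed auto
qed

end
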